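(* Let $F$ be an IPR fullerene and let $\varphi$ be a nontrivial partial automorphism of $F$, with domain $D=\operatorname{dom}(\varphi)$, of deficiency $k=|V(F)|-\operatorname{rank}(\varphi)\in\{1,2,3\}$. Then: (i) $\varphi$ is not face-localised: $\operatorname{supp}(\varphi)\not\subseteq V(F^\circ)$ for every face $F^\circ$ of $F$; (ii) there is no partition $D=C\sqcup R$ such that $\operatorname{supp}(\varphi)\subseteq C$, the set $R$ is fixed pointwise by $\varphi$, $|R|\ge 6$, and at most $5-k$ edges of $F$ join $C$ to $R$.
   Context: All graphs are finite, undirected and simple. A fullerene is a cubic, 3-connected, planar graph (with its essentially unique plane embedding) all of whose faces are pentagons or hexagons. It is IPR (isolated pentagon rule) if no two pentagonal faces are adjacent, i.e. no two pentagonal faces share an edge. $V(F^\circ)$ denotes the set of vertices on the boundary of a face $F^\circ$. A partial automorphism $\varphi$ of a graph $F$ is an isomorphism between two induced subgraphs of $F$; $\operatorname{dom}(\varphi)$ and $\operatorname{ran}(\varphi)$ are the vertex sets of these subgraphs and $\operatorname{rank}(\varphi)=|\operatorname{dom}(\varphi)|$. It is nontrivial if $\varphi(x)\ne x$ for some $x\in\operatorname{dom}(\varphi)$. Its support is $\operatorname{supp}(\varphi)=\{v\in\operatorname{dom}(\varphi):\varphi(v)\ne v\}\cup\{v\in\operatorname{ran}(\varphi):\varphi^{-1}(v)\ne v\}$. *)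

theory Defs
  imports "HOL-Analysis.Analysis"
begin

section \<open>Finite simple graphs\<close>

record 'a graph =
  verts :: "'a set"
  edges :: "'a set set"

definition simple_graph :: "('a, 'b) graph_scheme \<Rightarrow> bool" where
  "simple_graph G \<longleftrightarrow> finite (verts G) \<and> (\<forall>e\<in>edges G. e \<subseteq> verts G \<and> card e = 2)"

definition cubic :: "('a, 'b) graph_scheme \<Rightarrow> bool" where
  "cubic G \<longleftrightarrow> (\<forall>v\<in>verts G. card {e \<in> edges G. v \<in> e} = 3)"

definition induced_edges :: "('a, 'b) graph_scheme \<Rightarrow> 'a set \<Rightarrow> 'a set set" where
  "induced_edges G S = {e \<in> edges G. e \<subseteq> S}"

definition connected_induced :: "('a, 'b) graph_scheme \<Rightarrow> 'a set \<Rightarrow> bool" where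
  "connected_induced G S \<longleftrightarrow>
     S \<noteq> {} \<and> (\<forall>u\<in>S. \<forall>v\<in>S. (u, v) \<in> {(x, y). {x, y} \<in> induced_edges G S}\<^sup>*)"

definition k_connected :: "nat \<Rightarrow> ('a, 'b) graph_scheme \<Rightarrow> bool" where
  "k_connected k G \<longleftrightarrow>
     card (verts G) > k \<and>
     (\<forall>X \<subseteq> verts G. card X < k \<longrightarrow> connected_induced G (verts G - X))"

definition edges_between :: "('a, 'b) graph_scheme \<Rightarrow> 'a set \<Rightarrow> 'a set \<Rightarrow> 'a set set" where
  "edges_between G A B = {e \<in> edges G. \<exists>x\<in>A. \<exists>y\<in>B. e = {x, y}}"

definition cycle_edges :: "'a list \<Rightarrow> 'a set set" where
  "cycle_edges c = {{c ! i, c ! (Suc i mod length c)} | i. i < length c}"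

definition is_cycle :: "('a, 'b) graph_scheme \<Rightarrow> 'a list \<Rightarrow> bool" where
  "is_cycle G c \<longleftrightarrow> 3 \<le> length c \<and> distinct c \<and> cycle_edges c \<subseteq> edges G"


section \<open>Graphs drawn in the plane\<close>

text \<open>
  The plane is the type of complex numbers. A drawing places each vertex at a point and each
  edge along a curve; faces are the connected components of the complement of the drawing,
  so the unbounded face is included.
\<close>

record 'a drawn_graph = "'a graph" +
  position :: "'a \<Rightarrow> complex"
  curve :: "'a set \<Rightarrow> real \<Rightarrow> complex"

definition plane_graph :: "('a, 'b) drawn_graph_scheme \<Rightarrow> bool" where
  "plane_graph F \<longleftrightarrow>
     simple_graph F \<and>
     inj_on (position F) (verts F) \<and>
     (\<forall>e\<in>edges F. arc (curve F e) \<and>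
        {pathstart (curve F e), pathfinish (curve F e)} = position F ` e \<and>
        path_image (curve F e) \<inter> position F ` verts F = position F ` e) \<and>
     (\<forall>e\<in>edges F. \<forall>e'\<in>edges F. e \<noteq> e' \<longrightarrow>
        path_image (curve F e) \<inter> path_image (curve F e') = position F ` (e \<inter> e'))"

definition drawing :: "('a, 'b) drawn_graph_scheme \<Rightarrow> complex set" where
  "drawing F = position F ` verts F \<union> (\<Union>e\<in>edges F. path_image (curve F e))"

definition faces :: "('a, 'b) drawn_graph_scheme \<Rightarrow> complex set set" where
  "faces F = components (- drawing F)"

definition face_verts :: "('a, 'b) drawn_graph_scheme \<Rightarrow> complex set \<Rightarrow> 'a set" where
  "face_verts F f = {v \<in> verts F. position F v \<in> frontier f}"

definition face_edges :: "('a, 'b) drawn_graph_scheme \<Rightarrow> complex set \<Rightarrow> 'a set set" where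
  "face_edges F f = {e \<in> edges F. path_image (curve F e) \<subseteq> frontier f}"

definition bounded_by_cycle :: "('a, 'b) drawn_graph_scheme \<Rightarrow> complex set \<Rightarrow> nat \<Rightarrow> bool" where
  "bounded_by_cycle F f n \<longleftrightarrow>
     (\<exists>c. is_cycle F c \<and> length c = n \<and>
          frontier f = (\<Union>e\<in>cycle_edges c. path_image (curve F e)))"

abbreviation pentagonal :: "('a, 'b) drawn_graph_scheme \<Rightarrow> complex set \<Rightarrow> bool" where
  "pentagonal F f \<equiv> bounded_by_cycle F f 5"

abbreviation hexagonal :: "('a, 'b) drawn_graph_scheme \<Rightarrow> complex set \<Rightarrow> bool" where
  "hexagonal F f \<equiv> bounded_by_cycle F f 6"


section \<open>Fullerenes\<close>

text \<open>
  A fullerene carries a plane embedding as part of its data; since embeddings of 3-connected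
  planar graphs are essentially unique, none of the notions below depends on its choice.
\<close>

definition fullerene :: "('a, 'b) drawn_graph_scheme \<Rightarrow> bool" where
  "fullerene F \<longleftrightarrow>
     plane_graph F \<and> cubic F \<and> k_connected 3 F \<and>
     (\<forall>f\<in>faces F. pentagonal F f \<or> hexagonal F f)"

definition IPR :: "('a, 'b) drawn_graph_scheme \<Rightarrow> bool" where
  "IPR F \<longleftrightarrow>
     (\<forall>f\<in>faces F. \<forall>f'\<in>faces F.
        pentagonal F f \<and> pentagonal F f' \<and> f \<noteq> f' \<longrightarrow> face_edges F f \<inter> face_edges F f' = {})"


section \<open>Partial automorphisms\<close>

text \<open>Partial maps are represented as option-valued functions.\<close>

definition graph_isomorphism ::
  "('a \<Rightarrow> 'b) \<Rightarrow> 'a set \<Rightarrow> 'a set set \<Rightarrow> 'b set \<Rightarrow> 'b set set \<Rightarrow> bool" where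
  "graph_isomorphism h V E V' E' \<longleftrightarrow>
     bij_betw h V V' \<and> (\<forall>x\<in>V. \<forall>y\<in>V. {x, y} \<in> E \<longleftrightarrow> {h x, h y} \<in> E')"

definition partial_automorphism :: "('a, 'b) graph_scheme \<Rightarrow> ('a \<rightharpoonup> 'a) \<Rightarrow> bool" where
  "partial_automorphism G \<phi> \<longleftrightarrow>
     dom \<phi> \<subseteq> verts G \<and> ran \<phi> \<subseteq> verts G \<and>
     graph_isomorphism (the \<circ> \<phi>)
       (dom \<phi>) (induced_edges G (dom \<phi>)) (ran \<phi>) (induced_edges G (ran \<phi>))"

definition pa_rank :: "('a \<rightharpoonup> 'a) \<Rightarrow> nat" where
  "pa_rank \<phi> = card (dom \<phi>)"

definition deficiency :: "('a, 'b) graph_scheme \<Rightarrow> ('a \<rightharpoonup> 'a) \<Rightarrow> nat" where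
  "deficiency G \<phi> = card (verts G) - pa_rank \<phi>"

definition nontrivial :: "('a \<rightharpoonup> 'a) \<Rightarrow> bool" where
  "nontrivial \<phi> \<longleftrightarrow> (\<exists>x\<in>dom \<phi>. the (\<phi> x) \<noteq> x)"

definition supp :: "('a \<rightharpoonup> 'a) \<Rightarrow> 'a set" where
  "supp \<phi> = {v \<in> dom \<phi>. the (\<phi> v) \<noteq> v} \<union>
            {v \<in> ran \<phi>. the_inv_into (dom \<phi>) (the \<circ> \<phi>) v \<noteq> v}"

end

theory Submission
  imports Defs
begin

text \<open>
  Let \<open>D\<close> be the domain of \<open>\<phi>\<close> and suppose the support lies on one face. Then every vertex off
  the face that belongs to \<open>D\<close> is fixed. Each face vertex has exactly one neighbour off the
  face, and no two face vertices share it. If \<open>v\<close> is in the support, its outer neighbour cannot be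
  in \<open>D\<close>: it would be fixed, hence adjacent both to a moved vertex and to the image of that vertex.
  So the face vertices that are moved, hit by a moved vertex, or missing from \<open>D\<close> inject into
  the complement of \<open>D\<close>, and there are at most three of them. On the other hand, if \<open>m\<close> is sent
  to \<open>u \<noteq> m\<close>, a fixed face vertex is adjacent to both or to neither of \<open>m\<close> and \<open>u\<close>; as there are no
  triangles or four-cycles, \<open>m\<close>, \<open>u\<close> and the face vertices adjacent to exactly one of them are at
  least four vertices. This contradiction is \<open>not_face_localised\<close>.

  For the second claim, add to \<open>C\<close> the missing vertices with at least two neighbours in \<open>C\<close>.
  Every missing vertex then accounts for at most one edge leaving the enlarged set \<open>A\<close>, so at most
  five edges leave it, while at least six vertices lie outside. The classification \<open>small_cuts\<close> says
  that a side of such a cut which contains at most six pentagons is empty, or has at most three vertices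
  and induces a tree, or is the boundary of a pentagon. There are at most twelve pentagons, so it applies to
  one of the two sides; the side of \<open>R\<close> is too large for all outcomes, hence \<open>A\<close>, and with it \<open>C\<close>
  and the support, lies on a face, and the first claim applies.

  The classification is a curvature argument. Let \<open>s \<le> 5\<close> edges leave \<open>A\<close>. Since a cubic 3-connected graph
  is 3-edge-connected, both sides are connected, and Euler's formula for the sphere
  forces each side to have Euler characteristic 1. With \<open>p \<le> 6\<close> pentagons inside \<open>A\<close>, counting incidences
  shows that peeling off all vertices on faces that meet both sides leaves a set with at most
  \<open>s + p - 6 \<le> s\<close> leaving edges, to which induction applies. The counts exclude all cores except the
  empty one, where \<open>A\<close> is a pentagon, and a pentagon whose neighbours are all
  pentagons, which isolation forbids.

  What is needed of planarity is that every edge lies on exactly two faces and that the faces can be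
  two-coloured so that the edges between different colours are those of any given cycle. The second fact
  is the Jordan curve theorem and the first follows from Janiszewski's theorem. Together with
  linear algebra over the field with two elements, in the form \<open>odd_independent_card_le\<close>, they give Euler's
  formula.
\<close>

section \<open>Parity arguments for finite incidence structures\<close>

text \<open>
  The rows of a matrix over the field with two elements are linearly independent exactly if every nonempty set of
  rows has a nonzero sum, so there are at most as many rows as columns. Counting subsets replaces
  vector spaces: taking row sums is an injection from sets of rows to sets of columns.
\<close>

lemma odd_independent_card_le:
  assumes "finite N" "finite D"
    and ind: "\<And>S. S \<subseteq> N \<Longrightarrow> S \<noteq> {} \<Longrightarrow> \<exists>d\<in>D. odd (card {x \<in> S. R x d})"
  shows "card N \<le> card D"
proof -
  define bd where "bd S = {d \<in> D. odd (card {x \<in> S. R x d})}" for S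
  have sym: "odd (card {x \<in> sym_diff S S'. R x d}) \<longleftrightarrow>
      odd (card {x \<in> S. R x d}) \<noteq> odd (card {x \<in> S'. R x d})"
    if "S \<subseteq> N" "S' \<subseteq> N" for S S' d
  proof -
    let ?A = "{x \<in> S. R x d}" and ?B = "{x \<in> S'. R x d}"
    have fin: "finite ?A" "finite ?B"
      using that \<open>finite N\<close> by (auto intro: finite_subset)
    have A: "card ?A = card (?A \<inter> ?B) + card (?A - ?B)"
      by (rule card_Int_Diff[OF fin(1)])
    have B: "card ?B = card (?A \<inter> ?B) + card (?B - ?A)"
      using card_Int_Diff[OF fin(2), of ?A] by (simp only: Int_commute)
    have "{x \<in> sym_diff S S'. R x d} = (?A - ?B) \<union> (?B - ?A)" by auto
    moreover have "card ((?A - ?B) \<union> (?B - ?A)) = card (?A - ?B) + card (?B - ?A)"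
      using fin by (intro card_Un_disjoint) auto
    ultimately have "card {x \<in> sym_diff S S'. R x d} = card (?A - ?B) + card (?B - ?A)"
      by simp
    with A B show ?thesis by presburger
  qed
  have "inj_on bd (Pow N)"
  proof (rule inj_onI, rule ccontr)
    fix S S' assume S: "S \<in> Pow N" "S' \<in> Pow N" and eq: "bd S = bd S'" and "S \<noteq> S'"
    then have "sym_diff S S' \<noteq> {}" "sym_diff S S' \<subseteq> N" by auto
    then obtain d where d: "d \<in> D" "odd (card {x \<in> sym_diff S S'. R x d})"
      using ind by meson
    have "d \<in> bd S \<longleftrightarrow> d \<in> bd S'" using eq by simp
    then show False using d sym[of S S' d] S by (auto simp: bd_def)
  qed
  moreover have "bd ` Pow N \<subseteq> Pow D" by (auto simp: bd_def)
  ultimately have "card (Pow N) \<le> card (Pow D)"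
    by (meson card_inj_on_le assms(2) finite_Pow_iff)
  then show ?thesis using assms by (simp add: card_Pow)
qed

definition crossing :: "'a set set \<Rightarrow> 'a set \<Rightarrow> 'a set set" where
  "crossing X S = {e \<in> X. e \<inter> S \<noteq> {} \<and> \<not> e \<subseteq> S}"

definition connects :: "'a set set \<Rightarrow> 'a set \<Rightarrow> bool" where
  "connects X A \<longleftrightarrow> (\<forall>S. S \<subset> A \<longrightarrow> S \<noteq> {} \<longrightarrow> crossing X S \<noteq> {})"

lemma finite_crossing: "finite X \<Longrightarrow> finite (crossing X S)"
  by (simp add: crossing_def)

lemma card_crossing_Int:
  assumes "e \<in> crossing X S" "card e = 2"
  shows "card (e \<inter> S) = 1"
proof -
  obtain x y where "e = {x, y}" "x \<noteq> y" using assms(2) by (auto simp: card_2_iff)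
  then show ?thesis using assms(1) by (auto simp: crossing_def Int_insert_left)
qed

lemma odd_sumE:
  assumes "odd (sum f A)"
  obtains x where "x \<in> A" "odd (f x)"
  using assms dvd_sum[of A 2 f] by blast

lemma degree_sum:
  assumes "finite X" "finite S" and two: "\<And>e. e \<in> X \<Longrightarrow> card e = 2"
  shows "(\<Sum>v\<in>S. card {e \<in> X. v \<in> e}) = 2 * card {e \<in> X. e \<subseteq> S} + card (crossing X S)"
proof -
  have "(\<Sum>v\<in>S. card {e \<in> X. v \<in> e}) = (\<Sum>e\<in>X. card (e \<inter> S))"
  proof (rule sum_multicount_gen[OF assms(2,1)], intro ballI)
    fix e show "card {v \<in> S. v \<in> e} = card (e \<inter> S)"
      by (rule arg_cong[of _ _ card]) auto
  qed
  also have "\<dots> = (\<Sum>e\<in>X. (if e \<subseteq> S then 2 else 0) + (if e \<in> crossing X S then 1 else 0))"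
  proof (rule sum.cong[OF refl])
    fix e assume e: "e \<in> X"
    consider "e \<subseteq> S" | "e \<in> crossing X S" "\<not> e \<subseteq> S" | "e \<inter> S = {}" "\<not> e \<subseteq> S"
      using e two[OF e] by (auto simp: crossing_def)
    then show "card (e \<inter> S) = (if e \<subseteq> S then 2 else 0) + (if e \<in> crossing X S then 1 else 0)"
    proof cases
      case 1
      then show ?thesis using two[OF e] by (simp add: Int_absorb2 crossing_def)
    next
      case 2
      then show ?thesis using two[OF e] card_crossing_Int by auto
    next
      case 3
      then show ?thesis by (simp add: crossing_def)
    qed
  qed
  also have "\<dots> = 2 * card {e \<in> X. e \<subseteq> S} + card {e \<in> X. e \<in> crossing X S}"
    using assms(1) by (simp add: sum.distrib sum.If_cases Int_def mult.commute)
  also have "{e \<in> X. e \<in> crossing X S} = crossing X S" by (auto simp: crossing_def)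
  finally show ?thesis .
qed

text \<open>
  A minimal connecting edge set plays the part of a spanning tree. That it has no cycles is expressed by
  every edge being the only one across some vertex set, which is the form the parity arguments use.
\<close>

lemma minimal_connects:
  assumes "finite X" "connects X A"
  obtains T where "T \<subseteq> X" "connects T A"
    "\<forall>e\<in>T. \<exists>S. S \<subset> A \<and> S \<noteq> {} \<and> crossing T S = {e}"
proof -
  have "\<exists>T. (T \<subseteq> X \<and> connects T A) \<and> (\<forall>T'. T' \<subseteq> X \<and> connects T' A \<longrightarrow> card T \<le> card T')"
    by (rule ex_has_least_nat) (use assms(2) in blast)
  then obtain T where T: "T \<subseteq> X" "connects T A"
    and least: "\<And>T'. T' \<subseteq> X \<Longrightarrow> connects T' A \<Longrightarrow> card T \<le> card T'" by blast
  have "\<exists>S. S \<subset> A \<and> S \<noteq> {} \<and> crossing T S = {e}" if e: "e \<in> T" for e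
  proof -
    have "card (T - {e}) < card T"
      using e finite_subset[OF T(1) assms(1)] by (intro card_Diff1_less)
    then have "\<not> connects (T - {e}) A" using least[of "T - {e}"] T(1) by auto
    then obtain S where S: "S \<subset> A" "S \<noteq> {}" "crossing (T - {e}) S = {}"
      by (auto simp: connects_def)
    have "crossing T S \<noteq> {}" using T(2) S by (simp add: connects_def)
    moreover have "crossing T S \<subseteq> {e}" using S(3) by (auto simp: crossing_def)
    ultimately show ?thesis using S(1,2) by blast
  qed
  then show thesis by (intro that[OF T] ballI)
qed

text \<open>
  After removal of one vertex, the rows of the vertex-edge incidence matrix of a connected graph are independent.
\<close>

lemma connects_card:
  assumes "finite T" "finite A" "connects T A" and two: "\<And>e. e \<in> T \<Longrightarrow> card e = 2"
  shows "card A \<le> card T + 1"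
proof (cases "A = {}")
  case False
  then obtain v where v: "v \<in> A" by blast
  have "card (A - {v}) \<le> card T"
  proof (rule odd_independent_card_le[where R = "\<lambda>x e. x \<in> e"])
    fix S assume S: "S \<subseteq> A - {v}" "S \<noteq> {}"
    then have "S \<subset> A" using v by blast
    then obtain e where e: "e \<in> crossing T S"
      using assms(3) S(2) unfolding connects_def by blast
    then have "e \<in> T" by (simp add: crossing_def)
    then have "card (e \<inter> S) = 1" using card_crossing_Int[OF e] two by blast
    moreover have "{x \<in> S. x \<in> e} = e \<inter> S" by auto
    ultimately have "odd (card {x \<in> S. x \<in> e})" by simp
    then show "\<exists>e\<in>T. odd (card {x \<in> S. x \<in> e})"
      using \<open>e \<in> T\<close> by blast
  qed (use assms in auto)
  then show ?thesis using v assms(2) by simp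
qed simp

text \<open>
  Here the columns of the incidence matrix are independent: among the edges of \<open>X\<close>, only \<open>e\<close> crosses a suitable \<open>S\<close>,
  so the degrees in \<open>X\<close> of the vertices of \<open>S\<close> have an odd sum and one of them is odd.
\<close>

lemma all_bridges_card:
  assumes "finite T" "finite A" "A \<noteq> {}" and edge: "\<And>e. e \<in> T \<Longrightarrow> e \<subseteq> A \<and> card e = 2"
    and bridge: "\<And>e. e \<in> T \<Longrightarrow> \<exists>S\<subseteq>A. crossing T S = {e}"
  shows "card T + 1 \<le> card A"
proof -
  obtain v where v: "v \<in> A" using assms(3) by blast
  have "card T \<le> card (A - {v})"
  proof (rule odd_independent_card_le[where R = "\<lambda>e x. x \<in> e"])
    fix X assume X: "X \<subseteq> T" "X \<noteq> {}"
    then obtain e where e: "e \<in> X" by blast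
    have "e \<in> T" using e X(1) by (rule rev_subsetD)
    from bridge[OF this] obtain S0 where S0: "S0 \<subseteq> A" "crossing T S0 = {e}" by blast
    (* S0 and its complement are crossed by the same edges; take the one that avoids v. *)
    define S where "S = (if v \<in> S0 then A - S0 else S0)"
    have "crossing T (A - S0) = crossing T S0"
      unfolding crossing_def using edge by (intro Collect_cong) blast
    then have "crossing T S = {e}" using S0 by (simp add: S_def)
    moreover have "crossing X S = X \<inter> crossing T S"
      using X(1) by (auto simp: crossing_def)
    ultimately have "crossing X S = {e}" using e by simp
    have SA: "S \<subseteq> A - {v}" using S0 by (auto simp: S_def)
    have fin: "finite S" "finite X"
      using SA X assms(1,2) by (auto intro: finite_subset)
    have "(\<Sum>x\<in>S. card {d \<in> X. x \<in> d}) = 2 * card {e \<in> X. e \<subseteq> S} + card (crossing X S)"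
      using X edge by (intro degree_sum fin) blast
    then have "odd (\<Sum>x\<in>S. card {d \<in> X. x \<in> d})"
      using \<open>crossing X S = {e}\<close> by simp
    then obtain x where "x \<in> S" "odd (card {d \<in> X. x \<in> d})"
      by (rule odd_sumE)
    then show "\<exists>x\<in>A - {v}. odd (card {d \<in> X. x \<in> d})" using SA by blast
  qed (use assms in auto)
  moreover have "card (A - {v}) + 1 = card A"
    using v assms(2) by (metis Suc_eq_plus1 card_Suc_Diff1)
  ultimately show ?thesis by linarith
qed

lemma subsets_meet:
  assumes "finite C" "A \<subseteq> C" "B \<subseteq> C" "card C < card A + card B"
  shows "A \<inter> B \<noteq> {}"
proof
  assume "A \<inter> B = {}"
  then have "card (A \<union> B) = card A + card B"
    using assms by (intro card_Un_disjoint) (auto intro: finite_subset)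
  then show False using assms card_mono[of C "A \<union> B"] by simp
qed

section \<open>Paths and cycles\<close>

fun path_edges :: "'a list \<Rightarrow> 'a set set" where
  "path_edges (x # y # p) = insert {x, y} (path_edges (y # p))"
| "path_edges _ = {}"

lemma path_edges_suffix: "path_edges q \<subseteq> path_edges (p @ q)"
proof (induction p)
  case (Cons x p)
  then show ?case by (cases "p @ q") auto
qed simp

lemma path_edges_subset: "e \<in> path_edges p \<Longrightarrow> e \<subseteq> set p"
  by (induction p rule: path_edges.induct) auto

lemma path_edges_nth: "path_edges p = {{p ! i, p ! Suc i} | i. Suc i < length p}"
proof (induction p rule: path_edges.induct)
  case (1 x y p)
  have "{{(x # y # p) ! i, (x # y # p) ! Suc i} | i. Suc i < length (x # y # p)} =
     insert {x, y} {{(y # p) ! i, (y # p) ! Suc i} | i. Suc i < length (y # p)}" (is "?L = ?R")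
  proof
    show "?L \<subseteq> ?R"
    proof
      fix e assume "e \<in> ?L"
      then obtain i where i: "e = {(x # y # p) ! i, (x # y # p) ! Suc i}" "Suc i < length (x # y # p)"
        by blast
      then show "e \<in> ?R" by (cases i) auto
    qed
    show "?R \<subseteq> ?L"
    proof
      fix e assume "e \<in> ?R"
      then consider "e = {x, y}" | i where "e = {(y # p) ! i, (y # p) ! Suc i}" "Suc i < length (y # p)"
        by blast
      then show "e \<in> ?L"
      proof cases
        case 1 then show ?thesis by (intro CollectI exI[of _ 0]) auto
      next
        case 2 then show ?thesis by (intro CollectI exI[of _ "Suc i"]) auto
      qed
    qed
  qed
  then show ?case using 1 by simp
qed auto

lemma cycle_edges_eq_insert_path_edges:
  assumes "c \<noteq> []"
  shows "cycle_edges c = insert {last c, hd c} (path_edges c)"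
proof -
  have "cycle_edges c = (\<lambda>i. {c ! i, c ! (Suc i mod length c)}) ` {..<length c}"
    by (auto simp: cycle_edges_def)
  also have "{..<length c} = insert (length c - 1) {i. Suc i < length c}"
    using assms by (auto simp: Suc_lessI)
  also have "(\<lambda>i. {c ! i, c ! (Suc i mod length c)}) ` \<dots> =
     insert {last c, hd c} ((\<lambda>i. {c ! i, c ! Suc i}) ` {i. Suc i < length c})"
    using assms by (auto simp: last_conv_nth hd_conv_nth)
  also have "(\<lambda>i. {c ! i, c ! Suc i}) ` {i. Suc i < length c} = path_edges c"
    by (auto simp: path_edges_nth)
  finally show ?thesis .
qed

text \<open>
  The vertices from which \<open>v\<close> can be reached form a set that no edge of \<open>X\<close> leaves.
\<close>

lemma path_if_not_separated:
  assumes "u \<in> A" "v \<in> A" and edge: "\<And>e. e \<in> X \<Longrightarrow> e \<subseteq> A \<and> card e = 2"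
    and sep: "\<And>S. S \<subseteq> A \<Longrightarrow> v \<in> S \<Longrightarrow> u \<notin> S \<Longrightarrow> crossing X S \<noteq> {}"
  obtains p where "p \<noteq> []" "distinct p" "hd p = u" "last p = v" "path_edges p \<subseteq> X"
proof -
  define good where "good w p \<longleftrightarrow> p \<noteq> [] \<and> distinct p \<and> hd p = w \<and> last p = v \<and> path_edges p \<subseteq> X"
    for w p
  define S where "S = {w \<in> A. \<exists>p. good w p}"
  have "u \<in> S"
  proof (rule ccontr)
    assume "u \<notin> S"
    have "good v [v]" by (simp add: good_def)
    then have "v \<in> S" using assms(2) by (auto simp: S_def)
    then obtain e where e: "e \<in> crossing X S"
      using sep[of S] \<open>u \<notin> S\<close> by (auto simp: S_def)
    have eX: "e \<in> X" using e by (simp add: crossing_def)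
    obtain x y where xy: "e = {x, y}" "x \<in> S" "y \<notin> S" "y \<in> A"
    proof -
      obtain a b where ab: "e = {a, b}" using edge[OF eX] by (auto simp: card_2_iff)
      show thesis
        using that[of a b] that[of b a] e ab edge[OF eX] by (auto simp: crossing_def insert_commute)
    qed
    obtain p where p: "good x p" using xy by (auto simp: S_def)
    then obtain q where q: "p = x # q" by (cases p) (auto simp: good_def)
    have "y \<notin> set p"
    proof
      assume "y \<in> set p"
      then obtain a b where ab: "p = a @ y # b" by (meson split_list)
      then have "good y (y # b)"
        using p path_edges_suffix[of "y # b" a] by (auto simp: good_def)
      then show False using xy by (auto simp: S_def)
    qed
    then have "good y (y # p)"
      using p xy eX q by (auto simp: good_def insert_commute)
    then show False using xy by (auto simp: S_def)
  qed
  then show thesis using that by (auto simp: S_def good_def)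
qed

text \<open>
  The closing edge lies outside \<open>X\<close>; this rules out the path that consists of that edge alone, whose closure
  would run along it twice.
\<close>

lemma path_closes_to_cycle:
  assumes "p \<noteq> []" "distinct p" "path_edges p \<subseteq> X" "X \<subseteq> edges G"
    "{last p, hd p} \<in> edges G" "{last p, hd p} \<notin> X" "last p \<noteq> hd p"
  shows "is_cycle G p" "cycle_edges p = insert {last p, hd p} (path_edges p)"
proof -
  show ce: "cycle_edges p = insert {last p, hd p} (path_edges p)"
    by (rule cycle_edges_eq_insert_path_edges[OF assms(1)])
  have "3 \<le> length p"
  proof (rule ccontr)
    assume "\<not> 3 \<le> length p"
    then consider a where "p = [a]" | a b where "p = [a, b]"
      using assms(1) by (auto simp: not_le numeral_3_eq_3 less_Suc_eq_le le_Suc_eq length_Suc_conv)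
    then show False
    proof cases
      case 1
      then show ?thesis using assms by simp
    next
      case 2
      then show ?thesis using assms by (simp add: insert_commute)
    qed
  qed
  then show "is_cycle G p" using assms ce by (auto simp: is_cycle_def)
qed

lemma path_edges_snoc:
  "q \<noteq> [] \<Longrightarrow> path_edges (q @ [x]) = insert {last q, x} (path_edges q)"
  by (induction q rule: path_edges.induct) auto

lemma cycle_edges_rotate1: "cycle_edges (rotate1 c) = cycle_edges c"
proof (cases c)
  case (Cons x q)
  show ?thesis
  proof (cases "q = []")
    case False
    then obtain y r where q: "q = y # r" by (cases q) auto
    have "cycle_edges (rotate1 c) = insert {x, hd q} (path_edges (q @ [x]))"
      using Cons False by (simp add: cycle_edges_eq_insert_path_edges)
    also have "\<dots> = insert {x, hd q} (insert {last q, x} (path_edges q))"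
      using False by (simp add: path_edges_snoc)
    also have "\<dots> = insert {last q, x} (path_edges (x # q))"
      using q by (simp add: insert_commute)
    also have "\<dots> = cycle_edges c"
      using Cons False by (simp add: cycle_edges_eq_insert_path_edges)
    finally show ?thesis .
  qed (use Cons in simp)
qed simp

lemma cycle_edges_rotate: "cycle_edges (rotate k c) = cycle_edges c"
  by (induction k) (simp_all add: cycle_edges_rotate1)

lemma is_cycle_rotate: "is_cycle G c \<Longrightarrow> is_cycle G (rotate k c)"
  by (simp add: is_cycle_def cycle_edges_rotate)

text \<open>
  Up to rotation, any edge of a cycle is the closing one, so that what is left of the cycle is a path.
\<close>

lemma cycle_through_edge:
  assumes "is_cycle G c" "e \<in> cycle_edges c"
  obtains x y r where "is_cycle G (x # y # r)" "r \<noteq> []" "cycle_edges (x # y # r) = cycle_edges c"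
    "e = {last r, x}"
proof -
  obtain i where i: "i < length c" "e = {c ! i, c ! (Suc i mod length c)}"
    using assms(2) by (auto simp: cycle_edges_def)
  define c' where "c' = rotate (Suc i) c"
  have c': "is_cycle G c'" "cycle_edges c' = cycle_edges c"
    using assms(1) by (simp_all add: c'_def is_cycle_rotate cycle_edges_rotate del: rotate_Suc)
  have len: "3 \<le> length c" using assms(1) by (simp add: is_cycle_def)
  then have ne: "c \<noteq> []" "c' \<noteq> []" "length c' = length c" by (auto simp: c'_def)
  have "hd c' = c ! (Suc i mod length c)"
    unfolding c'_def using ne(1) by (rule hd_rotate_conv_nth)
  moreover have "last c' = c ! i"
  proof -
    have "last c' = rotate (Suc i) c ! (length c - 1)"
      using ne by (simp add: last_conv_nth c'_def)
    also have "\<dots> = c ! ((Suc i + (length c - 1)) mod length c)"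
      using len by (intro nth_rotate) auto
    also have "Suc i + (length c - 1) = i + length c" using len by simp
    finally show ?thesis using i(1) by simp
  qed
  ultimately have e: "e = {last c', hd c'}" using i(2) by (simp only:)
  obtain x y z q where "c' = x # y # z # q"
    using len ne(3) by (metis Suc_le_length_iff numeral_3_eq_3)
  then show thesis using that[of x y "z # q"] c' e by simp
qed

lemma closing_edge_notin_path:
  assumes "distinct (x # y # r)" "r \<noteq> []"
  shows "{last r, x} \<notin> path_edges (x # y # r)"
proof
  have "last r \<in> set r" using assms(2) by simp
  then have "last r \<noteq> y" "last r \<noteq> x" using assms(1) by auto
  assume "{last r, x} \<in> path_edges (x # y # r)"
  then consider "{last r, x} = {x, y}" | "{last r, x} \<in> path_edges (y # r)" by auto
  then show False
  proof cases
    case 1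
    then show ?thesis using \<open>last r \<noteq> y\<close> by (auto simp: doubleton_eq_iff)
  next
    case 2
    then have "x \<in> set (y # r)" using path_edges_subset by blast
    then show ?thesis using assms(1) by auto
  qed
qed

lemma cycle_edges_Cons_Cons:
  assumes "r \<noteq> []"
  shows "cycle_edges (x # y # r) = insert {last r, x} (path_edges (x # y # r))"
  using assms by (subst cycle_edges_eq_insert_path_edges) auto

lemma Union_path_edges: "2 \<le> length p \<Longrightarrow> \<Union>(path_edges p) = set p"
proof (induction p rule: path_edges.induct)
  case (1 x y p)
  then show ?case by (cases p) auto
qed auto

lemma Union_cycle_edges:
  assumes "is_cycle G c"
  shows "\<Union>(cycle_edges c) = set c"
proof -
  have len: "2 \<le> length c" using assms by (simp add: is_cycle_def)
  then have "c \<noteq> []" by auto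
  then show ?thesis
    using Union_path_edges[OF len] by (auto simp: cycle_edges_eq_insert_path_edges)
qed

lemma card_cycle_edges_at_vertex:
  assumes "is_cycle G c" "v \<in> set c"
  shows "card {e \<in> cycle_edges c. v \<in> e} = 2"
proof -
  obtain i where i: "i < length c" "c ! i = v" using assms(2) by (meson in_set_conv_nth)
  define c' where "c' = rotate i c"
  have c': "is_cycle G c'" "cycle_edges c' = cycle_edges c"
    using assms(1) by (simp_all add: c'_def is_cycle_rotate cycle_edges_rotate)
  have "c \<noteq> []" using i by auto
  then have hd: "hd c' = v" using i by (simp add: c'_def hd_rotate_conv_nth)
  have "3 \<le> length c'" using c'(1) by (simp add: is_cycle_def)
  then obtain x y z q where c'_eq: "c' = x # y # z # q"
    by (metis Suc_le_length_iff numeral_3_eq_3)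
  then have x: "x = v" using hd by simp
  define r where "r = z # q"
  have dist: "distinct (v # y # r)" "r \<noteq> []"
    using c'(1) c'_eq x by (auto simp: is_cycle_def r_def)
  have ce: "cycle_edges c = insert {last r, v} (insert {v, y} (path_edges (y # r)))"
    using cycle_edges_Cons_Cons[OF dist(2), of v y] c'(2) c'_eq x by (simp add: r_def)
  have "v \<notin> e" if "e \<in> path_edges (y # r)" for e
    using path_edges_subset[OF that] dist(1) by auto
  then have "{e \<in> cycle_edges c. v \<in> e} = {{last r, v}, {v, y}}" unfolding ce by auto
  moreover have "last r \<noteq> y" using dist by auto
  then have "{last r, v} \<noteq> {v, y}" by (auto simp: doubleton_eq_iff)
  ultimately show ?thesis by simp
qed

lemma crossing_path_edges:
  assumes "set p \<inter> S \<noteq> {}" "\<not> set p \<subseteq> S"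
  shows "crossing (path_edges p) S \<noteq> {}"
  using assms
proof (induction p rule: path_edges.induct)
  case (1 x y p)
  show ?case
  proof (cases "x \<in> S \<longleftrightarrow> y \<in> S")
    case True
    then have "crossing (path_edges (y # p)) S \<noteq> {}" using 1 by auto
    then show ?thesis by (auto simp: crossing_def)
  next
    case False
    then have "{x, y} \<in> crossing (path_edges (x # y # p)) S" by (auto simp: crossing_def)
    then show ?thesis by blast
  qed
qed auto

lemma connects_cycle_edges: "c \<noteq> [] \<Longrightarrow> connects (cycle_edges c) (set c)"
  unfolding connects_def
proof (intro allI impI)
  fix S assume "c \<noteq> []" "S \<subset> set c" "S \<noteq> {}"
  then have "crossing (path_edges c) S \<noteq> {}" by (intro crossing_path_edges) auto
  then show "crossing (cycle_edges c) S \<noteq> {}"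
    using \<open>c \<noteq> []\<close> by (auto simp: cycle_edges_eq_insert_path_edges crossing_def)
qed

section \<open>Face systems of isolated-pentagon fullerenes\<close>

text \<open>
  The combinatorial content of an isolated-pentagon fullerene: faces are abstract indices with a vertex set and an edge set.
  Assumption \<open>edge_faces\<close> and \<open>face_degree\<close> say that faces fit together to a closed surface; \<open>jordan\<close> makes
  this surface a sphere, since it says that every cycle is the boundary modulo 2 of a set of faces.
\<close>

locale fullerene_map =
  fixes V :: "'a set" and E :: "'a set set" and Fc :: "'f set"
    and fv :: "'f \<Rightarrow> 'a set" and fe :: "'f \<Rightarrow> 'a set set"
  assumes finite_V: "finite V" and V_nonempty: "V \<noteq> {}"
    and edge: "e \<in> E \<Longrightarrow> e \<subseteq> V \<and> card e = 2"
    and degree: "v \<in> V \<Longrightarrow> card {e \<in> E. v \<in> e} = 3"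
    and edge_connectivity: "S \<subseteq> V \<Longrightarrow> S \<noteq> {} \<Longrightarrow> S \<noteq> V \<Longrightarrow> 3 \<le> card (crossing E S)"
    and finite_Fc: "finite Fc"
    and face_verts_subset: "f \<in> Fc \<Longrightarrow> fv f \<subseteq> V"
    and face_edges_subset: "f \<in> Fc \<Longrightarrow> fe f \<subseteq> E"
    and face_size: "f \<in> Fc \<Longrightarrow> card (fv f) = 5 \<or> card (fv f) = 6"
    and face_degree: "f \<in> Fc \<Longrightarrow> v \<in> fv f \<Longrightarrow> card {e \<in> fe f. v \<in> e} = 2"
    and face_edge_verts: "f \<in> Fc \<Longrightarrow> e \<in> fe f \<Longrightarrow> e \<subseteq> fv f"
    and face_connected: "f \<in> Fc \<Longrightarrow> connects (fe f) (fv f)"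
    and edge_faces: "e \<in> E \<Longrightarrow> card {f \<in> Fc. e \<in> fe f} = 2"
    and jordan: "is_cycle \<lparr>verts = V, edges = E\<rparr> c \<Longrightarrow>
      \<exists>Q \<subseteq> Fc. \<forall>e\<in>E. e \<in> cycle_edges c \<longleftrightarrow> card {f \<in> Q. e \<in> fe f} = 1"
    and isolated_pentagons: "f \<in> Fc \<Longrightarrow> g \<in> Fc \<Longrightarrow> f \<noteq> g \<Longrightarrow>
      card (fv f) = 5 \<Longrightarrow> card (fv g) = 5 \<Longrightarrow> fe f \<inter> fe g = {}"
begin

lemma finite_E: "finite E"
  using edge finite_V by (intro finite_subset[of E "Pow V"]) auto

lemma finite_fv: "f \<in> Fc \<Longrightarrow> finite (fv f)"
  using face_verts_subset finite_V by (metis finite_subset)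

lemma finite_fe: "f \<in> Fc \<Longrightarrow> finite (fe f)"
  using face_edges_subset finite_E by (metis finite_subset)

lemma face_nonempty: "f \<in> Fc \<Longrightarrow> fv f \<noteq> {}"
  using face_size by fastforce

lemma card_faces_at_vertex:
  assumes "v \<in> V"
  shows "card {f \<in> Fc. v \<in> fv f} = 3"
proof -
  let ?s = "{e \<in> E. v \<in> e}" and ?t = "{f \<in> Fc. v \<in> fv f}"
  have "(\<Sum>e\<in>?s. card {f \<in> ?t. e \<in> fe f}) = 2 * card ?t"
  proof (rule sum_multicount)
    show "\<forall>f\<in>?t. card {e \<in> ?s. e \<in> fe f} = 2"
    proof
      fix f assume f: "f \<in> ?t"
      have "{e \<in> ?s. e \<in> fe f} = {e \<in> fe f. v \<in> e}"
        using f face_edges_subset by blast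
      then show "card {e \<in> ?s. e \<in> fe f} = 2" using face_degree f by simp
    qed
  qed (use finite_E finite_Fc in auto)
  moreover have "(\<Sum>e\<in>?s. card {f \<in> ?t. e \<in> fe f}) = (\<Sum>e\<in>?s. 2)"
  proof (rule sum.cong[OF refl])
    fix e assume e: "e \<in> ?s"
    have "{f \<in> ?t. e \<in> fe f} = {f \<in> Fc. e \<in> fe f}"
      using e face_edge_verts by blast
    then show "card {f \<in> ?t. e \<in> fe f} = 2" using edge_faces e by simp
  qed
  ultimately show ?thesis using degree[OF assms] by simp
qed

lemma face_at_vertex:
  assumes "v \<in> V"
  obtains f where "f \<in> Fc" "v \<in> fv f"
proof -
  have "card {f \<in> Fc. v \<in> fv f} \<noteq> 0" using card_faces_at_vertex[OF assms] by simp
  then have "{f \<in> Fc. v \<in> fv f} \<noteq> {}" by (metis card.empty)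
  then show thesis using that by blast
qed

lemma face_at_vertex_uses_one_of_two_edges:
  assumes "e \<in> E" "e' \<in> E" "e \<noteq> e'" "v \<in> e" "v \<in> e'" "f \<in> Fc" "v \<in> fv f"
  shows "e \<in> fe f \<or> e' \<in> fe f"
proof (rule ccontr)
  assume no: "\<not> ?thesis"
  have v: "v \<in> V" using edge assms by blast
  have "{d \<in> fe f. v \<in> d} \<subseteq> {d \<in> E. v \<in> d} - {e, e'}"
    using no face_edges_subset assms by blast
  then have "card {d \<in> fe f. v \<in> d} \<le> card ({d \<in> E. v \<in> d} - {e, e'})"
    using finite_E by (intro card_mono) auto
  also have "\<dots> = card {d \<in> E. v \<in> d} - card {e, e'}"
    using assms by (intro card_Diff_subset) auto
  also have "\<dots> = 1" using degree[OF v] assms(3) by simp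
  finally show False using face_degree[OF assms(6,7)] by simp
qed

lemma faces_at_vertex_share_edge:
  assumes "f \<in> Fc" "g \<in> Fc" "v \<in> fv f" "v \<in> fv g"
  obtains e where "e \<in> fe f" "e \<in> fe g" "v \<in> e"
proof -
  have v: "v \<in> V" using face_verts_subset assms by blast
  have "{e \<in> fe f. v \<in> e} \<inter> {e \<in> fe g. v \<in> e} \<noteq> {}"
    using face_degree[OF assms(1,3)] face_degree[OF assms(2,4)] degree[OF v]
      face_edges_subset[OF assms(1)] face_edges_subset[OF assms(2)] finite_E
    by (intro subsets_meet[of "{e \<in> E. v \<in> e}"]) auto
  then show thesis using that by blast
qed

lemma face_through_two_edges:
  assumes "e \<in> E" "e' \<in> E" "v \<in> e" "v \<in> e'"
  obtains f where "f \<in> Fc" "e \<in> fe f" "e' \<in> fe f"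
proof -
  have v: "v \<in> V" using edge assms by blast
  have "{f \<in> Fc. e \<in> fe f} \<inter> {f \<in> Fc. e' \<in> fe f} \<noteq> {}"
    using card_faces_at_vertex[OF v] edge_faces assms finite_Fc face_edge_verts
    by (intro subsets_meet[of "{f \<in> Fc. v \<in> fv f}"]) auto
  then show thesis using that by blast
qed

text \<open>
  If a set of faces had empty boundary, it would contain with a face all faces that share an edge with it.
  Any two faces at a vertex share an edge, so the vertices on the set form a union of components of the graph, hence
  are all vertices.
\<close>

lemma face_set_boundary_nonempty:
  assumes N: "N \<subseteq> Fc" "N \<noteq> {}" "N \<noteq> Fc"
  shows "\<exists>e\<in>E. odd (card {f \<in> N. e \<in> fe f})"
proof (rule ccontr)
  assume even: "\<not> ?thesis"
  have all_or_none: "g \<in> N" if "e \<in> fe f" "e \<in> fe g" "f \<in> N" "g \<in> Fc" for e f g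
  proof (rule ccontr)
    assume "g \<notin> N"
    have f: "f \<in> Fc" using N that by blast
    have e: "e \<in> E" using face_edges_subset that by blast
    have fin: "finite {f \<in> Fc. e \<in> fe f}" using finite_Fc by simp
    have "{f \<in> N. e \<in> fe f} \<subset> {f \<in> Fc. e \<in> fe f}"
      using N that \<open>g \<notin> N\<close> by blast
    then have "card {f \<in> N. e \<in> fe f} < 2"
      using psubset_card_mono[OF fin] edge_faces[OF e] by simp
    moreover have "card {f \<in> N. e \<in> fe f} \<noteq> 0"
      using that N finite_Fc by (auto simp: finite_subset)
    ultimately have "card {f \<in> N. e \<in> fe f} = 1" by linarith
    then show False using even e by fastforce
  qed
  define S where "S = (\<Union>f\<in>N. fv f)"
  have "S \<noteq> {}" using N face_nonempty by (auto simp: S_def)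
  have SV: "S \<subseteq> V" using N face_verts_subset by (auto simp: S_def)
  have "S = V"
  proof (rule ccontr)
    assume "S \<noteq> V"
    then have "crossing E S \<noteq> {}"
      using edge_connectivity[OF SV \<open>S \<noteq> {}\<close>] by fastforce
    then obtain e x y where e: "e \<in> E" "x \<in> e" "x \<in> S" "y \<in> e" "y \<notin> S"
      by (auto simp: crossing_def)
    obtain f where f: "f \<in> N" "x \<in> fv f" using e by (auto simp: S_def)
    have "{f \<in> Fc. e \<in> fe f} \<noteq> {}" using edge_faces[OF e(1)] by force
    then obtain g where g: "g \<in> Fc" "e \<in> fe g" by blast
    have "x \<in> fv g" "y \<in> fv g" using g e face_edge_verts by blast+
    have "f \<in> Fc" using f N by blast
    obtain d where "d \<in> fe f" "d \<in> fe g"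
      using faces_at_vertex_share_edge[OF \<open>f \<in> Fc\<close> g(1) f(2) \<open>x \<in> fv g\<close>] by blast
    then have "g \<in> N" using all_or_none f(1) g(1) by blast
    then show False using \<open>y \<in> fv g\<close> e by (auto simp: S_def)
  qed
  have "Fc \<subseteq> N"
  proof
    fix g assume g: "g \<in> Fc"
    then obtain x where x: "x \<in> fv g" using face_nonempty by blast
    then have "x \<in> S" using face_verts_subset g \<open>S = V\<close> by blast
    then obtain f where f: "f \<in> N" "x \<in> fv f" by (auto simp: S_def)
    have "f \<in> Fc" using f N by blast
    obtain d where "d \<in> fe f" "d \<in> fe g"
      using faces_at_vertex_share_edge[OF \<open>f \<in> Fc\<close> g f(2) x] by blast
    then show "g \<in> N" using all_or_none f(1) g by blast
  qed
  then show False using N by blast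
qed

lemma face_set_boundary_even:
  assumes "N \<subseteq> Fc"
  shows "even (card {e \<in> {e \<in> E. odd (card {f \<in> N. e \<in> fe f})}. v \<in> e})"
proof -
  let ?s = "{e \<in> E. v \<in> e}"
  have "finite N" using assms finite_Fc by (rule finite_subset)
  have "(\<Sum>e\<in>?s. card {f \<in> N. e \<in> fe f}) = (\<Sum>f\<in>N. card {e \<in> ?s. e \<in> fe f})"
    by (rule sum_multicount_gen) (use finite_E \<open>finite N\<close> in auto)
  moreover have "even (\<Sum>f\<in>N. card {e \<in> ?s. e \<in> fe f})"
  proof (rule dvd_sum)
    fix f assume "f \<in> N"
    then have f: "f \<in> Fc" using assms by blast
    have eq: "{e \<in> ?s. e \<in> fe f} = {e \<in> fe f. v \<in> e}"
      using face_edges_subset[OF f] by blast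
    show "even (card {e \<in> ?s. e \<in> fe f})"
    proof (cases "v \<in> fv f")
      case True
      then show ?thesis using eq face_degree[OF f] by simp
    next
      case False
      then have "{e \<in> fe f. v \<in> e} = {}" using face_edge_verts[OF f] by blast
      then have "card {e \<in> ?s. e \<in> fe f} = 0" by (simp only: eq card.empty)
      then show ?thesis by simp
    qed
  qed
  ultimately have "even (\<Sum>e\<in>?s. card {f \<in> N. e \<in> fe f})" by simp
  moreover have "finite ?s" using finite_E by simp
  ultimately have "even (card {e \<in> ?s. odd (card {f \<in> N. e \<in> fe f})})"
    by (simp only: even_sum_iff)
  moreover have "{e \<in> ?s. odd (card {f \<in> N. e \<in> fe f})} =
      {e \<in> {e \<in> E. odd (card {f \<in> N. e \<in> fe f})}. v \<in> e}" by blast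
  ultimately show ?thesis by simp
qed

text \<open>
  The Euler characteristic of the subcomplex induced on a connected \<open>A\<close> is at most 1 as soon as one face is missing. The
  boundary of a nonempty set of its faces is a nonempty even edge set, and so is not contained in a spanning
  tree \<open>T\<close>; hence the faces are independent modulo 2 already on the edges outside \<open>T\<close>.
\<close>

lemma card_inner_faces_le:
  assumes A: "A \<subseteq> V" "connects {e \<in> E. e \<subseteq> A} A"
    and N: "N \<subseteq> Fc" "N \<noteq> Fc" and inner: "\<And>f. f \<in> N \<Longrightarrow> fv f \<subseteq> A"
  shows "card N + card A \<le> card {e \<in> E. e \<subseteq> A} + 1"
proof -
  let ?X = "{e \<in> E. e \<subseteq> A}"
  have fin: "finite ?X" "finite A" "finite N"
    using finite_E finite_V finite_Fc A N by (auto intro: finite_subset)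
  obtain T where T: "T \<subseteq> ?X" "connects T A"
    and bridge: "\<forall>e\<in>T. \<exists>S. S \<subset> A \<and> S \<noteq> {} \<and> crossing T S = {e}"
    by (rule minimal_connects[OF fin(1) A(2)])
  have finT: "finite T" using T(1) fin(1) by (rule finite_subset)
  have cT: "card A \<le> card T + 1"
    using T edge by (intro connects_card finT fin(2)) auto
  have "card N \<le> card (?X - T)"
  proof (rule odd_independent_card_le[where R = "\<lambda>f e. e \<in> fe f"])
    fix S assume S: "S \<subseteq> N" "S \<noteq> {}"
    have SF: "S \<subseteq> Fc" "S \<noteq> Fc" using S N by blast+
    define bd where "bd = {e \<in> E. odd (card {f \<in> S. e \<in> fe f})}"
    have bd_in: "bd \<subseteq> ?X"
    proof
      fix e assume "e \<in> bd"
      then have e: "e \<in> E" "odd (card {f \<in> S. e \<in> fe f})" by (auto simp: bd_def)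
      then have "{f \<in> S. e \<in> fe f} \<noteq> {}" by force
      then obtain f where f: "f \<in> S" "e \<in> fe f" by blast
      then have "e \<subseteq> fv f" using face_edge_verts SF by blast
      then show "e \<in> ?X" using inner f S e by blast
    qed
    have "\<not> bd \<subseteq> T"
    proof
      assume bdT: "bd \<subseteq> T"
      (* As bd is a subset of T, only one of its edges crosses the set C that belongs to the bridge e; but its degrees are even. *)
      obtain e where e: "e \<in> bd"
        using face_set_boundary_nonempty[OF SF(1) S(2) SF(2)] by (auto simp: bd_def)
      from bspec[OF bridge subsetD[OF bdT e]] obtain C where C: "C \<subset> A" "crossing T C = {e}"
        by blast
      have "crossing bd C = bd \<inter> crossing T C" using bdT by (auto simp: crossing_def)
      then have cb: "crossing bd C = {e}" using C e by simp
      have "(\<Sum>v\<in>C. card {d \<in> bd. v \<in> d}) = 2 * card {d \<in> bd. d \<subseteq> C} + card (crossing bd C)"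
        using bdT finT C fin(2) edge bd_in by (intro degree_sum) (auto intro: finite_subset)
      then have "odd (\<Sum>v\<in>C. card {d \<in> bd. v \<in> d})" using cb by simp
      then obtain v where "odd (card {d \<in> bd. v \<in> d})" by (rule odd_sumE)
      then show False using face_set_boundary_even[OF SF(1)] by (simp add: bd_def)
    qed
    then obtain e where "e \<in> bd" "e \<notin> T" by blast
    then show "\<exists>e\<in>?X - T. odd (card {f \<in> S. e \<in> fe f})"
      using bd_in unfolding bd_def by blast
  qed (use fin in auto)
  also have "card (?X - T) = card ?X - card T"
    using T(1) finT by (intro card_Diff_subset) auto
  finally show ?thesis using cT card_mono[OF fin(1) T(1)] by linarith
qed

lemma connects_E: "connects E V"
  unfolding connects_def
proof (intro allI impI)
  fix S assume "S \<subset> V" "S \<noteq> {}"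
  then have "3 \<le> card (crossing E S)" using edge_connectivity by blast
  then show "crossing E S \<noteq> {}" by force
qed

text \<open>
  This is the half of Euler's formula that depends on the surface being a sphere. Take a spanning tree \<open>T\<close>.
  An edge outside \<open>T\<close> closes a cycle along \<open>T\<close>, and the colouring of the faces belonging to this cycle separates the
  two faces at that edge but those at no other edge outside \<open>T\<close>. So in the dual graph the edges outside \<open>T\<close> form a forest.
\<close>

lemma euler_ge: "card E + 2 \<le> card V + card Fc"
proof -
  obtain T where T: "T \<subseteq> E" "connects T V"
    and bridge: "\<forall>e\<in>T. \<exists>S. S \<subset> V \<and> S \<noteq> {} \<and> crossing T S = {e}"
    by (rule minimal_connects[OF finite_E connects_E])
  have finT: "finite T" using T(1) finite_E by (rule finite_subset)
  have "card T + 1 \<le> card V"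
  proof (rule all_bridges_card[OF finT finite_V V_nonempty])
    fix e assume e: "e \<in> T"
    show "e \<subseteq> V \<and> card e = 2" using edge T(1) e by blast
    show "\<exists>S\<subseteq>V. crossing T S = {e}" using bspec[OF bridge e] by blast
  qed
  moreover have "card (E - T) + 1 \<le> card Fc"
  proof -
    obtain f0 where f0: "f0 \<in> Fc" using V_nonempty face_at_vertex by blast
    have "card (E - T) \<le> card (Fc - {f0})"
    proof (rule odd_independent_card_le[where R = "\<lambda>e f. e \<in> fe f"])
      fix X assume X: "X \<subseteq> E - T" "X \<noteq> {}"
      then obtain e where e: "e \<in> X" by blast
      have eE: "e \<in> E" "e \<notin> T" using e X by auto
      obtain u w where uw: "e = {u, w}" "u \<noteq> w" using edge[OF eE(1)] by (auto simp: card_2_iff)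
      have "u \<in> V" "w \<in> V" using edge[OF eE(1)] uw by auto
      obtain p where p: "p \<noteq> []" "distinct p" "hd p = u" "last p = w" "path_edges p \<subseteq> T"
      proof (rule path_if_not_separated[OF \<open>u \<in> V\<close> \<open>w \<in> V\<close>, of T])
        show "\<And>e. e \<in> T \<Longrightarrow> e \<subseteq> V \<and> card e = 2" using T edge by blast
        show "crossing T S \<noteq> {}" if "S \<subseteq> V" "w \<in> S" "u \<notin> S" for S
          using T(2) that \<open>u \<in> V\<close> unfolding connects_def by blast
      qed blast
      have closing: "{last p, hd p} = e" using p(3,4) uw(1) by (simp add: insert_commute)
      have cyc: "is_cycle \<lparr>verts = V, edges = E\<rparr> p"
        and ce: "cycle_edges p = insert e (path_edges p)"
        using path_closes_to_cycle[OF p(1,2,5), of "\<lparr>verts = V, edges = E\<rparr>"] closing T(1) eE uw(2) p(3,4)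
        by simp_all
      from jordan[OF cyc] obtain Q0 where Q0: "Q0 \<subseteq> Fc"
        "\<forall>d\<in>E. d \<in> cycle_edges p \<longleftrightarrow> card {f \<in> Q0. d \<in> fe f} = 1" by blast
      (* Both colour classes serve; take the one without the face that was set aside. *)
      define Q where "Q = (if f0 \<in> Q0 then Fc - Q0 else Q0)"
      have QF: "Q \<subseteq> Fc - {f0}" using Q0 by (auto simp: Q_def)
      have finQ: "finite Q" using QF finite_Fc by (auto intro: finite_subset)
      have compl: "card {f \<in> Fc - Q0. d \<in> fe f} + card {f \<in> Q0. d \<in> fe f} = 2" if "d \<in> E" for d
      proof -
        have "{f \<in> Fc - Q0. d \<in> fe f} \<union> {f \<in> Q0. d \<in> fe f} = {f \<in> Fc. d \<in> fe f}"
          using Q0 by blast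
        moreover have "card ({f \<in> Fc - Q0. d \<in> fe f} \<union> {f \<in> Q0. d \<in> fe f}) =
          card {f \<in> Fc - Q0. d \<in> fe f} + card {f \<in> Q0. d \<in> fe f}"
          using finite_Fc Q0 by (intro card_Un_disjoint) (auto intro: finite_subset)
        ultimately show ?thesis using edge_faces[OF that] by simp
      qed
      have Q: "odd (card {f \<in> Q. d \<in> fe f}) \<longleftrightarrow> d \<in> cycle_edges p" if d: "d \<in> E" for d
      proof -
        have "card {f \<in> Q. d \<in> fe f} = card {f \<in> Q0. d \<in> fe f} \<or>
            card {f \<in> Q. d \<in> fe f} = card {f \<in> Fc - Q0. d \<in> fe f}"
          unfolding Q_def by (cases "f0 \<in> Q0") (simp_all only: if_True if_False simp_thms)
        moreover have "d \<in> cycle_edges p \<longleftrightarrow> card {f \<in> Q0. d \<in> fe f} = 1"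
          using Q0(2) d by (rule bspec)
        moreover have "(odd m \<longleftrightarrow> n = 1)" if "m = n \<or> m = k" "k + n = 2" for m n k :: nat
          using that by presburger
        ultimately show ?thesis using compl[OF d] by simp
      qed
      have finX: "finite X" using X finite_E by (auto intro: finite_subset)
      have "{d \<in> X. odd (card {f \<in> Q. d \<in> fe f})} = {e}"
      proof -
        have "{d \<in> X. odd (card {f \<in> Q. d \<in> fe f})} = X \<inter> cycle_edges p"
          using X Q by blast
        also have "\<dots> = {e}" using X p(5) e unfolding ce by blast
        finally show ?thesis .
      qed
      then have "odd (\<Sum>d\<in>X. card {f \<in> Q. d \<in> fe f})"
        using even_sum_iff[OF finX, of "\<lambda>d. card {f \<in> Q. d \<in> fe f}"] by simp
      moreover have "(\<Sum>d\<in>X. card {f \<in> Q. d \<in> fe f}) = (\<Sum>f\<in>Q. card {d \<in> X. d \<in> fe f})"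
        by (rule sum_multicount_gen) (use finX finQ in auto)
      ultimately have "odd (\<Sum>f\<in>Q. card {d \<in> X. d \<in> fe f})" by simp
      then obtain f where "f \<in> Q" "odd (card {d \<in> X. d \<in> fe f})" by (rule odd_sumE)
      then show "\<exists>f\<in>Fc - {f0}. odd (card {d \<in> X. d \<in> fe f})" using QF by blast
    qed (use finite_E finite_Fc in auto)
    then show ?thesis using f0 finite_Fc by (metis Suc_eq_plus1 Suc_le_mono card_Suc_Diff1)
  qed
  moreover have "card (E - T) = card E - card T"
    using T(1) finT by (intro card_Diff_subset) auto
  moreover have "card T \<le> card E" using T(1) finite_E by (intro card_mono)
  ultimately show ?thesis by linarith
qed

section \<open>Euler characteristic of one side of a small edge cut\<close>

abbreviation "inner_edges A \<equiv> {e \<in> E. e \<subseteq> A}"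
abbreviation "inner_faces A \<equiv> {f \<in> Fc. fv f \<subseteq> A}"
abbreviation "boundary_faces A \<equiv> {f \<in> Fc. fv f \<inter> A \<noteq> {} \<and> \<not> fv f \<subseteq> A}"
abbreviation "inner_pentagons A \<equiv> {f \<in> Fc. fv f \<subseteq> A \<and> card (fv f) = 5}"

lemma finite_sub: "A \<subseteq> V \<Longrightarrow> finite A"
  using finite_V by (rule rev_finite_subset)

lemma finite_inner [simp, intro]: "finite (inner_edges A)" "finite (inner_faces A)"
    "finite (boundary_faces A)" "finite (inner_pentagons A)" "finite (crossing E A)"
  using finite_E finite_Fc by (auto simp: crossing_def)

lemma crossing_Compl:
  assumes "A \<subseteq> V"
  shows "crossing E (V - A) = crossing E A"
  unfolding crossing_def using edge by (intro Collect_cong) blast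

lemma vertices_edges_cut:
  assumes "A \<subseteq> V"
  shows "3 * card A = 2 * card (inner_edges A) + card (crossing E A)"
proof -
  have "(\<Sum>v\<in>A. card {e \<in> E. v \<in> e}) = (\<Sum>v\<in>A. 3)"
    using assms degree by (intro sum.cong) auto
  moreover have "(\<Sum>v\<in>A. card {e \<in> E. v \<in> e}) = 2 * card (inner_edges A) + card (crossing E A)"
    using edge by (intro degree_sum finite_E finite_sub assms) blast
  ultimately show ?thesis by simp
qed

lemma cut_edge_face_is_boundary:
  assumes "e \<in> crossing E A" "f \<in> Fc" "e \<in> fe f"
  shows "f \<in> boundary_faces A"
  using assms face_edge_verts[OF assms(2,3)] by (auto simp: crossing_def)

text \<open>
  A closed boundary walk that leaves \<open>A\<close> also returns.
\<close>

lemma boundary_face_cut_ge: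
  assumes A: "A \<subseteq> V" and f: "f \<in> boundary_faces A"
  shows "2 \<le> card {e \<in> crossing E A. e \<in> fe f}"
proof -
  let ?S = "fv f \<inter> A"
  have fF: "f \<in> Fc" and "?S \<noteq> {}" and "?S \<subset> fv f" using f by auto
  have eq: "crossing (fe f) ?S = {e \<in> crossing E A. e \<in> fe f}"
    using face_edge_verts[OF fF] face_edges_subset[OF fF] by (auto simp: crossing_def)
  have ne: "crossing (fe f) ?S \<noteq> {}"
    using face_connected[OF fF] \<open>?S \<noteq> {}\<close> \<open>?S \<subset> fv f\<close> unfolding connects_def by blast
  have "(\<Sum>v\<in>?S. card {e \<in> fe f. v \<in> e}) = (\<Sum>v\<in>?S. 2)"
    using face_degree[OF fF] by (intro sum.cong) auto
  moreover have "(\<Sum>v\<in>?S. card {e \<in> fe f. v \<in> e}) =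
      2 * card {e \<in> fe f. e \<subseteq> ?S} + card (crossing (fe f) ?S)"
    using edge face_edges_subset[OF fF] finite_fv[OF fF]
    by (intro degree_sum finite_fe[OF fF]) auto
  ultimately have "2 * card {e \<in> fe f. e \<subseteq> ?S} + card (crossing (fe f) ?S) = card ?S * 2"
    by (simp only: sum_constant of_nat_id)
  then have "even (2 * card {e \<in> fe f. e \<subseteq> ?S} + card (crossing (fe f) ?S))" by simp
  then have "even (card (crossing (fe f) ?S))" by simp
  moreover have "card (crossing (fe f) ?S) \<noteq> 0"
    using ne finite_crossing[OF finite_fe[OF fF]] by simp
  moreover have "2 \<le> n" if "even n" "n \<noteq> 0" for n :: nat
    using that by presburger
  ultimately have "2 \<le> card (crossing (fe f) ?S)" by blast
  then show ?thesis by (simp only: eq)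
qed

lemma boundary_faces_le_cut:
  assumes A: "A \<subseteq> V"
  shows "card (boundary_faces A) \<le> card (crossing E A)"
proof -
  have "2 * card (boundary_faces A) = (\<Sum>f\<in>boundary_faces A. 2)" by simp
  also have "\<dots> \<le> (\<Sum>f\<in>boundary_faces A. card {e \<in> crossing E A. e \<in> fe f})"
    using boundary_face_cut_ge[OF A] by (intro sum_mono) blast
  also have "\<dots> = 2 * card (crossing E A)"
  proof (rule sum_multicount)
    show "\<forall>e\<in>crossing E A. card {f \<in> boundary_faces A. e \<in> fe f} = 2"
    proof
      fix e assume e: "e \<in> crossing E A"
      have "{f \<in> boundary_faces A. e \<in> fe f} = {f \<in> Fc. e \<in> fe f}"
        using cut_edge_face_is_boundary[OF e] by blast
      then show "card {f \<in> boundary_faces A. e \<in> fe f} = 2"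
        using edge_faces e by (simp add: crossing_def)
    qed
  qed auto
  finally show ?thesis by simp
qed

text \<open>
  Each of two parts of \<open>A\<close> without edges between them would be left by at least three edges of its own, all of which leave \<open>A\<close>.
\<close>

lemma small_cut_connects:
  assumes A: "A \<subseteq> V" and cut: "card (crossing E A) \<le> 5"
  shows "connects (inner_edges A) A"
  unfolding connects_def
proof (intro allI impI)
  fix S assume S: "S \<subset> A" "S \<noteq> {}"
  show "crossing (inner_edges A) S \<noteq> {}"
  proof
    assume none: "crossing (inner_edges A) S = {}"
    have sub: "crossing E S \<subseteq> crossing E A" "crossing E (A - S) \<subseteq> crossing E A"
      using none S by (auto simp: crossing_def)
    have "S \<subseteq> V" "S \<noteq> V" "A - S \<subseteq> V" "A - S \<noteq> V" "A - S \<noteq> {}" using S A by auto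
    then have "3 \<le> card (crossing E S)" "3 \<le> card (crossing E (A - S))"
      using edge_connectivity S(2) by blast+
    moreover have "crossing E S \<inter> crossing E (A - S) \<noteq> {}"
      using calculation cut by (intro subsets_meet[OF _ sub]) auto
    then obtain e where e: "e \<in> crossing E S" "e \<in> crossing E (A - S)" by blast
    have "card e = 2" using e(1) edge by (auto simp: crossing_def)
    then obtain x y where "e = {x, y}" by (auto simp: card_2_iff)
    then have "e \<in> crossing (inner_edges A) S" using e S by (auto simp: crossing_def)
    then show False using none by blast
  qed
qed

text \<open>
  Both sides have Euler characteristic at most 1. The boundary faces number at most as many as the leaving edges,
  so together these edges and faces contribute at most 0 to the characteristic of the sphere, which is
  at least 2. Hence equality holds throughout.
\<close>

lemma small_cut_euler:
  assumes A: "A \<subseteq> V" "A \<noteq> {}" "A \<noteq> V" and cut: "card (crossing E A) \<le> 5"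
  shows "card (inner_faces A) + card A = card (inner_edges A) + 1"
proof -
  have le: "card (inner_faces B) + card B \<le> card (inner_edges B) + 1"
    if B: "B \<subseteq> V" "B \<noteq> V" "card (crossing E B) \<le> 5" for B
  proof (rule card_inner_faces_le[OF B(1) small_cut_connects[OF B(1,3)]])
    obtain v where v: "v \<in> V" "v \<notin> B" using B by blast
    obtain f where "f \<in> Fc" "v \<in> fv f" using face_at_vertex[OF v(1)] .
    then show "inner_faces B \<noteq> Fc" using v by blast
  qed auto
  let ?B = "V - A"
  have leA: "card (inner_faces A) + card A \<le> card (inner_edges A) + 1"
    using le A cut by blast
  have leB: "card (inner_faces ?B) + card ?B \<le> card (inner_edges ?B) + 1"
    using le[of ?B] A cut crossing_Compl by auto
  have V: "card V = card A + card ?B"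
    using card_Int_Diff[OF finite_V, of A] A(1) by (simp add: Int_absorb1)
  have "E = inner_edges A \<union> inner_edges ?B \<union> crossing E A"
    using edge by (auto simp: crossing_def)
  moreover have "card (inner_edges A \<union> inner_edges ?B \<union> crossing E A) =
      card (inner_edges A) + card (inner_edges ?B) + card (crossing E A)"
  proof -
    have "e \<noteq> {}" if "e \<in> E" for e using edge[OF that] by force
    then have "inner_edges A \<inter> inner_edges ?B = {}" by blast
    moreover have "(inner_edges A \<union> inner_edges ?B) \<inter> crossing E A = {}"
      by (auto simp: crossing_def)
    ultimately show ?thesis by (simp add: card_Un_disjoint)
  qed
  ultimately have E: "card E = card (inner_edges A) + card (inner_edges ?B) + card (crossing E A)"
    by simp
  have "Fc = inner_faces A \<union> inner_faces ?B \<union> boundary_faces A"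
    using face_verts_subset by blast
  moreover have "card (inner_faces A \<union> inner_faces ?B \<union> boundary_faces A) =
      card (inner_faces A) + card (inner_faces ?B) + card (boundary_faces A)"
  proof -
    have "inner_faces A \<inter> inner_faces ?B = {}" using face_nonempty by blast
    moreover have "(inner_faces A \<union> inner_faces ?B) \<inter> boundary_faces A = {}" by auto
    ultimately show ?thesis by (simp add: card_Un_disjoint)
  qed
  ultimately have F: "card Fc =
      card (inner_faces A) + card (inner_faces ?B) + card (boundary_faces A)"
    by simp
  show ?thesis
    using leA leB V E F euler_ge boundary_faces_le_cut[OF A(1)] by linarith
qed

text \<open>
  Three faces meet at each vertex, and an inner face has six vertices unless it is a pentagon; the incidences that
  remain are those with boundary faces.
\<close>

lemma face_incidences:
  assumes A: "A \<subseteq> V"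
  shows "(\<Sum>v\<in>A. card {f \<in> boundary_faces A. v \<in> fv f}) + 6 * card (inner_faces A)
    = 3 * card A + card (inner_pentagons A)"
proof -
  have "(\<Sum>v\<in>A. card {f \<in> boundary_faces A. v \<in> fv f}) + (\<Sum>v\<in>A. card {f \<in> inner_faces A. v \<in> fv f})
      = (\<Sum>v\<in>A. 3)"
    unfolding sum.distrib[symmetric]
  proof (rule sum.cong[OF refl])
    fix v assume v: "v \<in> A"
    have "card ({f \<in> boundary_faces A. v \<in> fv f} \<union> {f \<in> inner_faces A. v \<in> fv f}) =
      card {f \<in> boundary_faces A. v \<in> fv f} + card {f \<in> inner_faces A. v \<in> fv f}"
      using finite_Fc by (intro card_Un_disjoint) auto
    moreover have "{f \<in> boundary_faces A. v \<in> fv f} \<union> {f \<in> inner_faces A. v \<in> fv f} =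
      {f \<in> Fc. v \<in> fv f}" using v by blast
    ultimately show "card {f \<in> boundary_faces A. v \<in> fv f} + card {f \<in> inner_faces A. v \<in> fv f} = 3"
      using card_faces_at_vertex v A by auto
  qed
  moreover have "(\<Sum>v\<in>A. card {f \<in> inner_faces A. v \<in> fv f}) = (\<Sum>f\<in>inner_faces A. card (fv f))"
  proof (rule sum_multicount_gen)
    show "\<forall>f\<in>inner_faces A. card {v \<in> A. v \<in> fv f} = card (fv f)"
    proof
      fix f assume "f \<in> inner_faces A"
      then have "{v \<in> A. v \<in> fv f} = fv f" by blast
      then show "card {v \<in> A. v \<in> fv f} = card (fv f)" by simp
    qed
  qed (use finite_sub[OF A] in auto)
  moreover have "(\<Sum>f\<in>inner_faces A. card (fv f)) + card (inner_pentagons A) = 6 * card (inner_faces A)"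
  proof -
    have "card (inner_pentagons A) = (\<Sum>f\<in>inner_faces A. if card (fv f) = 5 then 1 else 0)"
      by (simp add: sum.If_cases Int_def conj_ac)
    then have "(\<Sum>f\<in>inner_faces A. card (fv f)) + card (inner_pentagons A) =
        (\<Sum>f\<in>inner_faces A. card (fv f) + (if card (fv f) = 5 then 1 else 0))"
      by (simp only: sum.distrib)
    also have "\<dots> = (\<Sum>f\<in>inner_faces A. 6)"
      using face_size by (intro sum.cong) auto
    finally show ?thesis by simp
  qed
  ultimately show ?thesis by simp
qed

lemma inner_pentagons_le:
  assumes A: "A \<subseteq> V"
  shows "5 * card (inner_pentagons A) \<le> 3 * card A"
proof -
  have "(\<Sum>v\<in>A. card {f \<in> inner_pentagons A. v \<in> fv f}) = 5 * card (inner_pentagons A)"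
  proof (rule sum_multicount)
    show "\<forall>f\<in>inner_pentagons A. card {v \<in> A. v \<in> fv f} = 5"
    proof
      fix f assume f: "f \<in> inner_pentagons A"
      then have "{v \<in> A. v \<in> fv f} = fv f" by blast
      then show "card {v \<in> A. v \<in> fv f} = 5" using f by simp
    qed
  qed (use finite_sub[OF A] in auto)
  moreover have "(\<Sum>v\<in>A. card {f \<in> inner_pentagons A. v \<in> fv f}) \<le> (\<Sum>v\<in>A. 3)"
  proof (rule sum_mono)
    fix v assume "v \<in> A"
    then have "card {f \<in> Fc. v \<in> fv f} = 3" using card_faces_at_vertex A by blast
    then show "card {f \<in> inner_pentagons A. v \<in> fv f} \<le> 3"
      using card_mono[of "{f \<in> Fc. v \<in> fv f}" "{f \<in> inner_pentagons A. v \<in> fv f}"] finite_Fc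
      by auto
  qed
  ultimately show ?thesis by simp
qed

lemma total_counts:
  "3 * card V = 2 * card E" "6 * card Fc = 3 * card V + card (inner_pentagons V)"
proof -
  have inE: "inner_edges V = E" using edge by blast
  have inF: "inner_faces V = Fc" "boundary_faces V = {}" using face_verts_subset by blast+
  have "crossing E V = {}" using edge by (auto simp: crossing_def)
  then show "3 * card V = 2 * card E"
    using vertices_edges_cut[OF subset_refl] inE by simp
  show "6 * card Fc = 3 * card V + card (inner_pentagons V)"
    using face_incidences[OF subset_refl] inF by simp
qed

text \<open>
  The Euler characteristic of a connected closed surface is at most 2, and six times the characteristic is
  the number of pentagons.
\<close>

lemma card_inner_pentagons_total: "card (inner_pentagons V) \<le> 12"
proof -
  obtain f0 where f0: "f0 \<in> Fc" using V_nonempty face_at_vertex by blast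
  have inE: "inner_edges V = E" using edge by blast
  have "card (Fc - {f0}) + card V \<le> card E + 1"
    using card_inner_faces_le[of V "Fc - {f0}"] connects_E inE face_verts_subset f0 by auto
  moreover have "card (Fc - {f0}) + 1 = card Fc"
    using f0 finite_Fc by (metis Suc_eq_plus1 card_Suc_Diff1)
  ultimately show ?thesis using total_counts by linarith
qed

lemma half_has_few_pentagons:
  assumes "A \<subseteq> V"
  shows "card (inner_pentagons A) \<le> 6 \<or> card (inner_pentagons (V - A)) \<le> 6"
proof -
  have "card (inner_pentagons A \<union> inner_pentagons (V - A)) =
      card (inner_pentagons A) + card (inner_pentagons (V - A))"
    using face_nonempty by (intro card_Un_disjoint) fastforce+
  moreover have "card (inner_pentagons A \<union> inner_pentagons (V - A)) \<le> card (inner_pentagons V)"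
    using assms by (intro card_mono) auto
  ultimately show ?thesis using card_inner_pentagons_total by linarith
qed

section \<open>Edge cuts with at most five edges\<close>

text \<open>
  The proof is by induction on \<open>A\<close>. A vertex with at least two leaving edges can be dropped, which decreases the cut. Otherwise
  let \<open>A0\<close>, \<open>A1\<close>, \<open>A2\<close> collect the vertices of \<open>A\<close> on none, on exactly one, or on several of the faces that meet both sides.
  An end of a leaving edge is in \<open>A2\<close>, so \<open>s \<le> |A2|\<close>, and the incidence count with \<open>\<chi> = 1\<close> yields \<open>|A1| + 6 \<le> s + p\<close>.
  An edge that leaves \<open>A0\<close> ends in \<open>A1\<close>, and no two of these edges share that end. So the induction hypothesis
  applies to \<open>A0\<close>, which lies deeper inside.

  The hypothesis \<open>p \<le> 6\<close> selects the side of positive curvature; without it \<open>A\<close> could be the complement of a vertex.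
\<close>

theorem small_cuts:
  assumes "A \<subseteq> V" "A \<noteq> V" "card (crossing E A) \<le> 5" "card (inner_pentagons A) \<le> 6"
  shows "A = {} \<or> card A + 2 = card (crossing E A) \<or>
    card (crossing E A) = 5 \<and> (\<exists>f\<in>Fc. card (fv f) = 5 \<and> fv f = A)"
  using assms
proof (induction "card A" arbitrary: A rule: less_induct)
  case less
  note A = less.prems(1)
  have finA: "finite A" using finite_sub A .
  define s where "s = card (crossing E A)"
  define p where "p = card (inner_pentagons A)"
  have s5: "s \<le> 5" and p6: "p \<le> 6" using less.prems by (auto simp: s_def p_def)
  define d where "d v = card {e \<in> crossing E A. v \<in> e}" for v
  define \<beta> where "\<beta> v = card {f \<in> boundary_faces A. v \<in> fv f}" for v
  have pent_mono: "card (inner_pentagons B) \<le> 6" if "B \<subseteq> A" for B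
  proof -
    have "card (inner_pentagons B) \<le> card (inner_pentagons A)"
      using that by (intro card_mono) auto
    then show ?thesis using p6 by (simp add: p_def)
  qed
  have cutA: "3 * card A = 2 * card (inner_edges A) + s"
    using vertices_edges_cut[OF A] by (simp add: s_def)
  show ?case
  proof (cases "A = {}")
    case False
    have s3: "3 \<le> s" using edge_connectivity A False less.prems(2) by (simp add: s_def)
    have euler: "card (inner_faces A) + card A = card (inner_edges A) + 1"
      by (rule small_cut_euler[OF A False less.prems(2,3)])
    show ?thesis
    proof (cases "\<exists>v\<in>A. 2 \<le> d v")
      case True
      then obtain v where v: "v \<in> A" "2 \<le> d v" by blast
      define B where "B = A - {v}"
      have cB: "card A = card B + 1"
        using card.remove[OF finA v(1)] by (simp add: B_def)
      have star: "{e \<in> E. v \<in> e} = {e \<in> inner_edges A. v \<in> e} \<union> {e \<in> crossing E A. v \<in> e}"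
        using v(1) by (auto simp: crossing_def)
      have "card ({e \<in> inner_edges A. v \<in> e} \<union> {e \<in> crossing E A. v \<in> e}) =
          card {e \<in> inner_edges A. v \<in> e} + d v"
        unfolding d_def using finite_E
        by (intro card_Un_disjoint) (auto simp: crossing_def)
      then have deg: "card {e \<in> inner_edges A. v \<in> e} + d v = 3"
        using degree[OF subsetD[OF A v(1)]] by (simp only: star)
      have split: "inner_edges A = inner_edges B \<union> {e \<in> inner_edges A. v \<in> e}"
        by (auto simp: B_def)
      have "card (inner_edges B \<union> {e \<in> inner_edges A. v \<in> e}) =
          card (inner_edges B) + card {e \<in> inner_edges A. v \<in> e}"
        using finite_E by (intro card_Un_disjoint) (auto simp: B_def)
      then have iB: "card (inner_edges A) = card (inner_edges B) + card {e \<in> inner_edges A. v \<in> e}"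
        using arg_cong[OF split, of card] by (rule trans[rotated])
      have BV: "B \<subseteq> V" "B \<noteq> V" "B \<subseteq> A" using A v by (auto simp: B_def)
      have cutB: "3 * card B = 2 * card (inner_edges B) + card (crossing E B)"
        by (rule vertices_edges_cut[OF BV(1)])
      (* Dropping v replaces its d v leaving edges by the 3 - d v edges that joined it to the rest of A. *)
      have sB: "card (crossing E B) + 2 * d v = s + 3"
        using cutA cutB deg iB cB by linarith
      have "B = {} \<or> card B + 2 = card (crossing E B) \<or>
          card (crossing E B) = 5 \<and> (\<exists>f\<in>Fc. card (fv f) = 5 \<and> fv f = B)"
        using less.hyps[of B] cB BV sB s5 v(2) pent_mono[OF BV(3)] by auto
      then have "card A + 2 = s"
      proof (elim disjE conjE)
        assume "B = {}"
        then have "card (crossing E B) = 0" "card B = 0" by (auto simp: crossing_def)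
        then show ?thesis using sB cB deg s3 v(2) by linarith
      next
        assume B2: "card B + 2 = card (crossing E B)"
        have "card B \<noteq> 0"
        proof
          assume "card B = 0"
          then have "B = {}" using finite_sub[OF BV(1)] by simp
          then have "card (crossing E B) = 0" by (simp add: crossing_def)
          then show False using B2 by linarith
        qed
        then have "d v \<le> 2" using B2 sB s5 by linarith
        then show ?thesis using B2 sB cB v(2) by linarith
      next
        assume "card (crossing E B) = 5"
        then show ?thesis using sB s5 v(2) by linarith
      qed
      then show ?thesis by (simp add: s_def)
    next
      case False
      then have d1: "d v \<le> 1" if "v \<in> A" for v using that by force
      define A0 where "A0 = {v \<in> A. \<beta> v = 0}"
      define A1 where "A1 = {v \<in> A. \<beta> v = 1}"
      define A2 where "A2 = {v \<in> A. 2 \<le> \<beta> v}"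
      have fins: "finite A0" "finite A1" "finite A2" using finA by (auto simp: A0_def A1_def A2_def)
      have cA: "card A = card A0 + card A1 + card A2"
      proof -
        have "A = A0 \<union> A1 \<union> A2" by (auto simp: A0_def A1_def A2_def)
        moreover have "card (A0 \<union> A1 \<union> A2) = card A0 + card A1 + card A2"
        proof -
          have "A0 \<inter> A1 = {}" "(A0 \<union> A1) \<inter> A2 = {}" by (auto simp: A0_def A1_def A2_def)
          then show ?thesis using fins by (simp add: card_Un_disjoint)
        qed
        ultimately show ?thesis by simp
      qed
      have sum\<beta>: "card A1 + 2 * card A2 \<le> (\<Sum>v\<in>A. \<beta> v)"
      proof -
        have "card A1 + 2 * card A2 = (\<Sum>v\<in>A. (if \<beta> v = 1 then 1 else 0) + (if 2 \<le> \<beta> v then 2 else 0))"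
          using finA by (simp add: sum.distrib sum.If_cases A1_def A2_def Int_def)
        also have "\<dots> \<le> (\<Sum>v\<in>A. \<beta> v)" by (intro sum_mono) auto
        finally show ?thesis .
      qed
      have sA2: "s \<le> card A2"
      proof -
        have "(\<Sum>v\<in>A. d v) = 1 * card (crossing E A)"
          unfolding d_def
        proof (rule sum_multicount[OF finA])
          show "\<forall>e\<in>crossing E A. card {v \<in> A. v \<in> e} = 1"
          proof
            fix e assume e: "e \<in> crossing E A"
            have "card (e \<inter> A) = 1"
              using card_crossing_Int[OF e] e edge by (simp add: crossing_def)
            moreover have "{v \<in> A. v \<in> e} = e \<inter> A" by blast
            ultimately show "card {v \<in> A. v \<in> e} = 1" by simp
          qed
        qed auto
        moreover have "(\<Sum>v\<in>A. d v) \<le> (\<Sum>v\<in>A. if 2 \<le> \<beta> v then 1 else 0)"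
        proof (rule sum_mono)
          fix v assume v: "v \<in> A"
          (* Both faces at a leaving edge meet both sides. *)
          show "d v \<le> (if 2 \<le> \<beta> v then 1 else 0)"
          proof (cases "d v = 0")
            case False
            then have "{e \<in> crossing E A. v \<in> e} \<noteq> {}" unfolding d_def by (metis card.empty)
            then obtain e where e: "e \<in> crossing E A" "v \<in> e" by blast
            have "{f \<in> Fc. e \<in> fe f} \<subseteq> {f \<in> boundary_faces A. v \<in> fv f}"
              using cut_edge_face_is_boundary[OF e(1)] face_edge_verts e(2) by blast
            then have "card {f \<in> Fc. e \<in> fe f} \<le> \<beta> v"
              unfolding \<beta>_def using finite_Fc by (intro card_mono) auto
            then have "2 \<le> \<beta> v" using edge_faces e by (simp add: crossing_def)
            then show ?thesis using d1[OF v] by simp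
          qed simp
        qed
        moreover have "(\<Sum>v\<in>A. if 2 \<le> \<beta> v then 1 else 0) = card A2"
          using finA by (simp add: sum.If_cases A2_def Int_def)
        ultimately show ?thesis by (simp add: s_def)
      qed
      have inc: "(\<Sum>v\<in>A. \<beta> v) + 6 * card (inner_faces A) = 3 * card A + p"
        using face_incidences[OF A] by (simp add: \<beta>_def p_def)
      (* With the incidence count this bounds p in terms of the size of the core A0. *)
      have pF: "p \<le> card (inner_faces A)"
        unfolding p_def by (intro card_mono) auto
      have A1: "card A1 + 6 \<le> s + p"
        using inc sum\<beta> sA2 euler cutA by linarith
      have pA0: "p + 4 \<le> card A0 + s"
        using inc sum\<beta> sA2 euler cutA cA pF by linarith
      have A0V: "A0 \<subseteq> V" "A0 \<noteq> V" "A0 \<subseteq> A" using A less.prems(2) by (auto simp: A0_def)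
      have inner: "f \<in> inner_faces A" if "f \<in> Fc" "x \<in> fv f" "x \<in> A0" for f x
      proof -
        have "{f \<in> boundary_faces A. x \<in> fv f} = {}"
          using that(3) finite_Fc by (simp add: A0_def \<beta>_def)
        then show ?thesis using that A0V(3) by blast
      qed
      have cutA0: "card (crossing E A0) \<le> card A1"
      proof -
        have faces: "f \<in> inner_faces A"
          if e: "e \<in> crossing E A0" and f: "f \<in> Fc" "e \<in> fe f" for e f
        proof -
          obtain x where "x \<in> e" "x \<in> A0" using e unfolding crossing_def by blast
          then show ?thesis using inner[OF f(1)] face_edge_verts[OF f] by blast
        qed
        have out: "y \<in> A1" if e: "e \<in> crossing E A0" and y: "y \<in> e" "y \<notin> A0" for e y
        proof -
          have eE: "e \<in> E" using e by (simp add: crossing_def)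
          have yV: "y \<in> V" using edge[OF eE] y by blast
          have two: "card {f \<in> Fc. e \<in> fe f} = 2" by (rule edge_faces[OF eE])
          then have "{f \<in> Fc. e \<in> fe f} \<noteq> {}" by (metis card.empty zero_neq_numeral)
          then obtain f where f: "f \<in> Fc" "e \<in> fe f" by blast
          have yA: "y \<in> A" using faces[OF e f] face_edge_verts[OF f] y by blast
          (* Two of the three faces at y contain the end of e in A0 and so lie inside A. *)
          then have "\<beta> y \<noteq> 0" using y by (simp add: A0_def)
          moreover have "\<beta> y \<le> 1"
          proof -
            have "{f \<in> boundary_faces A. y \<in> fv f} \<subseteq>
                {f \<in> Fc. y \<in> fv f} - {f \<in> Fc. e \<in> fe f}"
              using faces[OF e] by blast
            then have "\<beta> y \<le> card ({f \<in> Fc. y \<in> fv f} - {f \<in> Fc. e \<in> fe f})"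
              unfolding \<beta>_def using finite_Fc by (intro card_mono) auto
            also have "\<dots> = card {f \<in> Fc. y \<in> fv f} - card {f \<in> Fc. e \<in> fe f}"
              using finite_Fc face_edge_verts y by (intro card_Diff_subset) auto
            finally show ?thesis using two card_faces_at_vertex[OF yV] by simp
          qed
          ultimately show ?thesis using yA by (simp add: A1_def)
        qed
        have "card (crossing E A0) = (\<Sum>e\<in>crossing E A0. 1)" by simp
        also have "\<dots> \<le> (\<Sum>e\<in>crossing E A0. card {y \<in> A1. y \<in> e})"
        proof (rule sum_mono)
          fix e assume e: "e \<in> crossing E A0"
          then obtain y where y: "y \<in> e" "y \<notin> A0" unfolding crossing_def by blast
          then have "{y} \<subseteq> {y \<in> A1. y \<in> e}" using out[OF e y] by blast
          then have "card {y} \<le> card {y \<in> A1. y \<in> e}" using fins by (intro card_mono) auto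
          then show "1 \<le> card {y \<in> A1. y \<in> e}" by simp
        qed
        also have "\<dots> = (\<Sum>y\<in>A1. card {e \<in> crossing E A0. y \<in> e})"
          by (rule sum_multicount_gen) (use fins in auto)
        also have "\<dots> \<le> (\<Sum>y\<in>A1. 1)"
        proof (rule sum_mono)
          fix y assume y: "y \<in> A1"
          have "e = e'" if "e \<in> crossing E A0" "y \<in> e" "e' \<in> crossing E A0" "y \<in> e'" for e e'
          proof (rule ccontr)
            assume "e \<noteq> e'"
            have "\<beta> y = 1" using y by (simp add: A1_def)
            then have "{f \<in> boundary_faces A. y \<in> fv f} \<noteq> {}"
              unfolding \<beta>_def by (metis card.empty zero_neq_one)
            then obtain f where f: "f \<in> boundary_faces A" "y \<in> fv f" by blast
            have "e \<in> fe f \<or> e' \<in> fe f"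
              using that f \<open>e \<noteq> e'\<close>
              by (intro face_at_vertex_uses_one_of_two_edges) (auto simp: crossing_def)
            then show False using faces that f by blast
          qed
          then have "\<forall>e\<in>{e \<in> crossing E A0. y \<in> e}. \<forall>e'\<in>{e \<in> crossing E A0. y \<in> e}. e = e'"
            by blast
          then show "card {e \<in> crossing E A0. y \<in> e} \<le> 1"
            using card_le_Suc0_iff_eq[of "{e \<in> crossing E A0. y \<in> e}"] by simp
        qed
        finally show ?thesis by simp
      qed
      have "card A0 < card A" using cA sA2 s3 by linarith
      moreover have "card (crossing E A0) \<le> 5" using cutA0 A1 s5 p6 by linarith
      ultimately have "A0 = {} \<or> card A0 + 2 = card (crossing E A0) \<or>
          card (crossing E A0) = 5 \<and> (\<exists>f\<in>Fc. card (fv f) = 5 \<and> fv f = A0)"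
        using less.hyps A0V(1,2) pent_mono[OF A0V(3)] by blast
      then show ?thesis
      proof (elim disjE conjE bexE)
        assume "A0 = {}"
        then have c0: "card A0 = 0" by simp
        (* Nothing is left after one layer: the bounds leave room for a single pentagon. *)
        have p1: "p = 1" and sA: "s = 5" using pA0 c0 A1 s5 by linarith+
        have cA5: "card A = 5"
          using c0 inc sum\<beta> sA2 euler cutA cA p1 sA by linarith
        have "inner_pentagons A \<noteq> {}" using p1 unfolding p_def by (metis card.empty zero_neq_one)
        then obtain f where f: "f \<in> Fc" "fv f \<subseteq> A" "card (fv f) = 5" by blast
        then have "fv f = A" using card_subset_eq[OF finA f(2)] cA5 by simp
        then show ?thesis using f sA by (auto simp: s_def)
      next
        assume "card A0 + 2 = card (crossing E A0)"
        (* With |A0| + 2 leaving edges the two bounds on p would give 12 \<le> 2 * s. *)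
        then show ?thesis using pA0 cutA0 A1 s5 by linarith
      next
        fix g assume c5: "card (crossing E A0) = 5" and g: "g \<in> Fc" "card (fv g) = 5" "fv g = A0"
        (* Equality holds everywhere, so all faces inside A are pentagons, also those around g. *)
        have p: "p = 6" using c5 cutA0 A1 s5 p6 by linarith
        have "card (inner_faces A) \<le> p"
          using c5 cutA0 A1 s5 inc sum\<beta> sA2 euler cutA cA g p by simp
        then have "card (inner_faces A) = card (inner_pentagons A)"
          using pF by (simp add: p_def)
        then have all: "inner_pentagons A = inner_faces A"
          by (intro card_subset_eq) auto
        obtain x where x: "x \<in> fv g" using face_nonempty g by blast
        have "{e \<in> fe g. x \<in> e} \<noteq> {}"
          using face_degree[OF g(1) x] by (metis card.empty zero_neq_numeral)
        then obtain e where e: "e \<in> fe g" "x \<in> e" by blast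
        have eE: "e \<in> E" using e face_edges_subset g by blast
        have "\<not> {f \<in> Fc. e \<in> fe f} \<subseteq> {g}"
        proof
          assume "{f \<in> Fc. e \<in> fe f} \<subseteq> {g}"
          from card_mono[OF _ this] show False using edge_faces[OF eE] by simp
        qed
        then obtain h where h: "h \<in> Fc" "e \<in> fe h" "h \<noteq> g" by blast
        have "x \<in> fv h" using face_edge_verts[OF h(1,2)] e by blast
        then have "h \<in> inner_faces A" using inner[OF h(1)] x g(3) by blast
        then have "card (fv h) = 5" using all by blast
        then have "fe h \<inter> fe g = {}" using isolated_pentagons h g by blast
        then show ?thesis using h e by blast
      qed
    qed
  qed simp
qed

section \<open>Short cycles and the neighbourhood of a face\<close>

text \<open>
  By \<open>euler_ge\<close> there are at least twelve pentagons. They need sixty incidences, and each vertex supplies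
  at most three.
\<close>

lemma card_V_ge: "20 \<le> card V"
  using total_counts euler_ge inner_pentagons_le[OF subset_refl] by linarith

text \<open>
  At most eleven vertices leave room for at most six pentagons, so \<open>small_cuts\<close> applies to \<open>A\<close>. A set that
  spans at least as many edges as it has vertices does not induce a tree, which leaves the pentagon. The
  statements about short cycles below are instances.
\<close>

lemma small_sets_are_sparse:
  assumes A: "A \<subseteq> V" and X: "X \<subseteq> E" "\<And>e. e \<in> X \<Longrightarrow> e \<subseteq> A"
    and size: "card A = a" "card X = x" and bounds: "0 < a" "a \<le> 11" "a \<le> x" "3 * a \<le> 2 * x + 5"
  shows "a = 5 \<and> x = 5"
proof -
  have "A \<noteq> V" "A \<noteq> {}" using card_V_ge size(1) bounds(1,2) by auto
  have "card X \<le> card (inner_edges A)" using X by (intro card_mono) auto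
  then have s: "card (crossing E A) + 2 * x \<le> 3 * a"
    using vertices_edges_cut[OF A] size by linarith
  then have s5: "card (crossing E A) \<le> 5" using bounds by linarith
  have "card (inner_pentagons A) \<le> 6" using inner_pentagons_le[OF A] size(1) bounds(2) by linarith
  from small_cuts[OF A \<open>A \<noteq> V\<close> s5 this] \<open>A \<noteq> {}\<close>
  consider "card A + 2 = card (crossing E A)"
    | "card (crossing E A) = 5" "card A = 5" by auto
  then show ?thesis
  proof cases
    case 1
    then show ?thesis using s size(1) bounds by linarith
  next
    case 2
    then have "a = 5" "x \<le> 5" using s size(1) by linarith+
    then show ?thesis using bounds(3) by simp
  qed
qed

lemma edge_ends_distinct: "{a, b} \<in> E \<Longrightarrow> a \<noteq> b"
  using edge[of "{a, b}"] by auto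

lemma no_triangle:
  assumes "{a, b} \<in> E" "{b, c} \<in> E" "{a, c} \<in> E"
  shows False
proof -
  have d: "a \<noteq> b" "b \<noteq> c" "a \<noteq> c" using edge_ends_distinct assms by auto
  have V: "{a, b, c} \<subseteq> V" using edge[OF assms(1)] edge[OF assms(2)] by blast
  have X: "{{a, b}, {b, c}, {a, c}} \<subseteq> E" using assms by blast
  have cX: "card {{a, b}, {b, c}, {a, c}} = 3" using d by (simp add: doubleton_eq_iff)
  have cA: "card {a, b, c} = 3" using d by simp
  have "(3::nat) = 5 \<and> (3::nat) = 5"
    by (rule small_sets_are_sparse[OF V X _ cA cX]) auto
  then show False by simp
qed

lemma no_four_cycle:
  assumes "{a, x} \<in> E" "{x, b} \<in> E" "{a, y} \<in> E" "{y, b} \<in> E" "a \<noteq> b"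
  shows "x = y"
proof (rule ccontr)
  assume "x \<noteq> y"
  have d: "a \<noteq> x" "x \<noteq> b" "a \<noteq> y" "y \<noteq> b" using edge_ends_distinct assms by auto
  have V: "{a, b, x, y} \<subseteq> V" using edge[OF assms(1)] edge[OF assms(4)] by blast
  have X: "{{a, x}, {x, b}, {a, y}, {y, b}} \<subseteq> E" using assms by blast
  have cX: "card {{a, x}, {x, b}, {a, y}, {y, b}} = 4"
    using d assms(5) \<open>x \<noteq> y\<close> by (simp add: doubleton_eq_iff)
  have cA: "card {a, b, x, y} = 4" using d assms(5) \<open>x \<noteq> y\<close> by simp
  have "(4::nat) = 5 \<and> (4::nat) = 5"
    by (rule small_sets_are_sparse[OF V X _ cA cX]) auto
  then show False by simp
qed

lemma card_face_edges:
  assumes f: "f \<in> Fc"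
  shows "card (fe f) = card (fv f)"
proof -
  have "(\<Sum>v\<in>fv f. card {e \<in> fe f. v \<in> e}) = (\<Sum>v\<in>fv f. 2)"
    using face_degree[OF f] by (intro sum.cong) auto
  moreover have "(\<Sum>v\<in>fv f. card {e \<in> fe f. v \<in> e}) =
      2 * card {e \<in> fe f. e \<subseteq> fv f} + card (crossing (fe f) (fv f))"
    using edge face_edges_subset[OF f]
    by (intro degree_sum finite_fe[OF f] finite_fv[OF f]) blast
  moreover have "{e \<in> fe f. e \<subseteq> fv f} = fe f" "crossing (fe f) (fv f) = {}"
    using face_edge_verts[OF f] by (auto simp: crossing_def)
  ultimately show ?thesis by simp
qed

lemma face_has_no_chord:
  assumes f: "f \<in> Fc" and e: "e \<in> E" "e \<subseteq> fv f"
  shows "e \<in> fe f"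
proof (rule ccontr)
  assume "e \<notin> fe f"
  then have cX: "card (insert e (fe f)) = card (fv f) + 1"
    using card_face_edges[OF f] finite_fe[OF f] by simp
  have X: "insert e (fe f) \<subseteq> E" using e face_edges_subset[OF f] by blast
  have "card (fv f) = 5 \<and> card (fv f) + 1 = (5::nat)"
  proof (rule small_sets_are_sparse[OF face_verts_subset[OF f] X _ refl cX])
    show "d \<subseteq> fv f" if "d \<in> insert e (fe f)" for d
      using that e(2) face_edge_verts[OF f] by blast
  qed (use face_size[OF f] in auto)
  then show False by (elim conjE) linarith
qed

lemma outer_neighbour_unique:
  assumes f: "f \<in> Fc" and w: "w \<notin> fv f" and a: "a \<in> fv f" "{w, a} \<in> E"
    and b: "b \<in> fv f" "{w, b} \<in> E"
  shows "a = b"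
proof (rule ccontr)
  assume "a \<noteq> b"
  let ?A = "insert w (fv f)" and ?X = "insert {w, a} (insert {w, b} (fe f))"
  have "{w, a} \<noteq> {w, b}" using \<open>a \<noteq> b\<close> by (simp add: doubleton_eq_iff)
  moreover have "{w, a} \<notin> fe f" "{w, b} \<notin> fe f" using face_edge_verts[OF f] w by blast+
  ultimately have cX: "card ?X = card (fv f) + 2"
    using card_face_edges[OF f] finite_fe[OF f] by simp
  have cA: "card ?A = card (fv f) + 1" using w finite_fv[OF f] by simp
  have X: "?X \<subseteq> E" using a b face_edges_subset[OF f] by blast
  have AV: "?A \<subseteq> V" using edge[OF a(2)] face_verts_subset[OF f] by auto
  have "card (fv f) + 1 = 5 \<and> card (fv f) + 2 = 5"
  proof (rule small_sets_are_sparse[OF AV X _ cA cX])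
    show "d \<subseteq> ?A" if "d \<in> ?X" for d
      using that a(1) b(1) face_edge_verts[OF f] by blast
  qed (use face_size[OF f] in auto)
  then show False by (elim conjE) linarith
qed

lemma card_neighbours:
  assumes "X \<subseteq> E"
  shows "card {u. {v, u} \<in> X} = card {e \<in> X. v \<in> e}"
proof (rule bij_betw_same_card)
  show "bij_betw (\<lambda>u. {v, u}) {u. {v, u} \<in> X} {e \<in> X. v \<in> e}"
  proof (rule bij_betw_imageI)
    show "inj_on (\<lambda>u. {v, u}) {u. {v, u} \<in> X}" by (auto simp: inj_on_def doubleton_eq_iff)
    show "(\<lambda>u. {v, u}) ` {u. {v, u} \<in> X} = {e \<in> X. v \<in> e}"
    proof
      show "{e \<in> X. v \<in> e} \<subseteq> (\<lambda>u. {v, u}) ` {u. {v, u} \<in> X}"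
      proof
        fix e assume e: "e \<in> {e \<in> X. v \<in> e}"
        then have "card e = 2" using assms edge by blast
        then obtain u where "e = {v, u}" using e by (auto simp: card_2_iff)
        then show "e \<in> (\<lambda>u. {v, u}) ` {u. {v, u} \<in> X}" using e by blast
      qed
    qed auto
  qed
qed

lemma outer_neighbour_exists:
  assumes f: "f \<in> Fc" and v: "v \<in> fv f"
  obtains w where "w \<in> V" "w \<notin> fv f" "{v, w} \<in> E"
proof (rule ccontr)
  note outer = that
  assume no: "\<not> thesis"
  have "e \<in> fe f" if e: "e \<in> E" "v \<in> e" for e
  proof (rule face_has_no_chord[OF f e(1)])
    have "card e = 2" "e \<subseteq> V" using edge[OF e(1)] by auto
    then obtain u where u: "e = {v, u}" "u \<in> V" using e(2) by (auto simp: card_2_iff)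
    then show "e \<subseteq> fv f" using no outer[of u] e v by blast
  qed
  then have "{e \<in> fe f. v \<in> e} = {e \<in> E. v \<in> e}" using face_edges_subset[OF f] by blast
  then show False
    using face_degree[OF f v] degree[OF subsetD[OF face_verts_subset[OF f] v]] by simp
qed

text \<open>
  Two vertices share at most one neighbour, and none if they are adjacent.
\<close>

lemma face_neighbourhoods_differ:
  assumes f: "f \<in> Fc" and m: "m \<in> fv f" and u: "u \<in> fv f" and "m \<noteq> u"
  defines "N \<equiv> \<lambda>v. {w. {v, w} \<in> fe f}"
  shows "4 \<le> card ({m, u} \<union> ((N m - N u) \<union> (N u - N m)))"
proof -
  have c: "card (N m) = 2" "card (N u) = 2"
    unfolding N_def using card_neighbours[OF face_edges_subset[OF f]] face_degree[OF f] m u by simp_all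
  have fin: "finite (N m)" "finite (N u)" using c by (auto intro: card_ge_0_finite)
  have E: "{v, w} \<in> E" if "w \<in> N v" for v w
    using that face_edges_subset[OF f] by (auto simp: N_def)
  have Nm: "card (N m) = card (N m \<inter> N u) + card (N m - N u)"
    by (rule card_Int_Diff[OF fin(1)])
  have Nu: "card (N u) = card (N m \<inter> N u) + card (N u - N m)"
    using card_Int_Diff[OF fin(2), of "N m"] by (simp only: Int_commute)
  have dis: "card ((N m - N u) \<union> (N u - N m)) = card (N m - N u) + card (N u - N m)"
    using fin by (intro card_Un_disjoint) auto
  show ?thesis
  proof (cases "N m \<inter> N u = {}")
    case True
    then have "card ((N m - N u) \<union> (N u - N m)) = 4" using c Nm Nu dis by simp
    moreover have "card ((N m - N u) \<union> (N u - N m)) \<le> card ({m, u} \<union> ((N m - N u) \<union> (N u - N m)))"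
      using fin by (intro card_mono) auto
    ultimately show ?thesis by linarith
  next
    case False
    then obtain x where x: "x \<in> N m" "x \<in> N u" by blast
    have "y = x" if "y \<in> N m \<inter> N u" for y
    proof -
      have "y \<in> N m" "y \<in> N u" using that by auto
      then have "{m, x} \<in> E" "{x, u} \<in> E" "{m, y} \<in> E" "{y, u} \<in> E"
        using E[OF x(1)] E[OF x(2)] E[of y m] E[of y u] by (simp_all add: insert_commute)
      then show ?thesis using no_four_cycle[of m x u y] \<open>m \<noteq> u\<close> by blast
    qed
    then have "N m \<inter> N u = {x}" using x by blast
    then have two: "card ((N m - N u) \<union> (N u - N m)) = 2" using c Nm Nu dis by simp
    have "{m, u} \<notin> E"
      using no_triangle[of m u x] E[OF x(1)] E[OF x(2)] by blast
    then have "u \<notin> N m" "m \<notin> N u" using E[of u m] E[of m u] by (auto simp: insert_commute)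
    moreover have "m \<notin> N m" "u \<notin> N u" using E[of m m] E[of u u] edge by fastforce+
    ultimately have "card ({m, u} \<union> ((N m - N u) \<union> (N u - N m))) =
        card {m, u} + card ((N m - N u) \<union> (N u - N m))"
      using fin by (intro card_Un_disjoint) auto
    then show ?thesis using two \<open>m \<noteq> u\<close> by simp
  qed
qed

section \<open>Maps supported on a face and weakly linked parts\<close>

theorem not_face_localised:
  assumes D: "D \<subseteq> V" and inj: "inj_on h D"
    and adj: "\<And>x y. x \<in> D \<Longrightarrow> y \<in> D \<Longrightarrow> {x, y} \<in> E \<longleftrightarrow> {h x, h y} \<in> E"
    and few: "card (V - D) \<le> 3" and f: "f \<in> Fc"
    and supp: "\<And>x. x \<in> D \<Longrightarrow> h x \<noteq> x \<Longrightarrow> x \<in> fv f \<and> h x \<in> fv f"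
    and m: "m \<in> D" "h m \<noteq> m"
  shows False
proof -
  let ?P = "fv f"
  define M where "M = {x \<in> D. h x \<noteq> x}"
  define S where "S = M \<union> h ` M"
  define W where "W = (?P \<inter> D) - S"
  have SP: "S \<subseteq> ?P" using supp by (auto simp: S_def M_def)
  have fixed: "h w = w" if "w \<in> D" "w \<notin> ?P" for w using supp that by blast
  have fixedW: "w \<in> D" "h w = w" if "w \<in> W" for w using that by (auto simp: W_def S_def M_def)
  have "\<forall>v\<in>?P. \<exists>w. w \<in> V \<and> w \<notin> ?P \<and> {v, w} \<in> E"
    using outer_neighbour_exists[OF f] by metis
  then obtain r where r: "\<forall>v\<in>?P. r v \<in> V \<and> r v \<notin> ?P \<and> {v, r v} \<in> E"
    by (rule bchoice[THEN exE])
  have r_inj: "a = b" if ab: "a \<in> ?P" "b \<in> ?P" "r a = r b" for a b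
  proof (rule outer_neighbour_unique[OF f, of "r a"])
    show "r a \<notin> ?P" "{r a, a} \<in> E" using r ab(1) by (auto simp: insert_commute)
    show "{r a, b} \<in> E" unfolding ab(3) using r ab(2) by (auto simp: insert_commute)
  qed (use ab in auto)
  (* A present outer neighbour is fixed, so it is adjacent to both x and h x, two vertices of the face. *)
  have r_notin: "r v \<notin> D" if v: "v \<in> S" for v
  proof
    assume rD: "r v \<in> D"
    have vP: "v \<in> ?P" using v SP by blast
    have rv: "r v \<notin> ?P" "{v, r v} \<in> E" using r vP by auto
    have hr: "h (r v) = r v" using fixed rD rv by blast
    obtain x where x: "x \<in> M" "v = x \<or> v = h x" using v by (auto simp: S_def)
    have xD: "x \<in> D" and hx: "h x \<noteq> x" using x by (auto simp: M_def)
    have xP: "x \<in> ?P" "h x \<in> ?P" using supp[OF xD hx] by auto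
    have "{x, r v} \<in> E \<longleftrightarrow> {h x, r v} \<in> E" using adj[OF xD rD] hr by simp
    then have "{r v, x} \<in> E" "{r v, h x} \<in> E" using rv(2) x(2) by (auto simp: insert_commute)
    then have "x = h x" by (intro outer_neighbour_unique[OF f rv(1)] xP)
    then show False using hx by simp
  qed
  (* Each face vertex outside W is charged to a missing vertex: itself or its outer neighbour. *)
  define t where "t v = (if v \<in> S then r v else v)" for v
  have "card (?P - W) \<le> card (V - D)"
  proof (rule card_inj_on_le)
    show "inj_on t (?P - W)"
    proof (rule inj_onI)
      fix a b assume ab: "a \<in> ?P - W" "b \<in> ?P - W" "t a = t b"
      show "a = b"
        using ab r r_inj by (auto simp: t_def split: if_splits)
    qed
    show "t ` (?P - W) \<subseteq> V - D"
    proof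
      fix y assume "y \<in> t ` (?P - W)"
      then obtain v where v: "v \<in> ?P" "v \<notin> W" "y = t v" by blast
      show "y \<in> V - D"
      proof (cases "v \<in> S")
        case True
        then show ?thesis using v r r_notin by (auto simp: t_def)
      next
        case False
        then show ?thesis using v face_verts_subset[OF f] by (auto simp: t_def W_def)
      qed
    qed
  qed (use finite_V in auto)
  moreover have "4 \<le> card (?P - W)"
  proof -
    define N where "N = (\<lambda>v. {w. {v, w} \<in> fe f})"
    have mh: "m \<in> ?P" "h m \<in> ?P" using supp[OF m] by auto
    have mS: "m \<in> S" "h m \<in> S" using m by (auto simp: S_def M_def)
    have NP: "w \<in> ?P" "{v, w} \<in> E" if "w \<in> N v" for v w
      using that face_edge_verts[OF f, of "{v, w}"] face_edges_subset[OF f] by (auto simp: N_def)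
    have NI: "w \<in> N v" if "w \<in> ?P" "v \<in> ?P" "{v, w} \<in> E" for v w
      using that face_has_no_chord[OF f, of "{v, w}"] by (auto simp: N_def)
    have "w \<in> N m \<longleftrightarrow> w \<in> N (h m)" if w: "w \<in> W" for w
    proof -
      have "w \<in> ?P" using w by (simp add: W_def)
      moreover have "{m, w} \<in> E \<longleftrightarrow> {h m, w} \<in> E"
        using adj[OF m(1) fixedW(1)[OF w]] fixedW(2)[OF w] by simp
      ultimately show ?thesis using NP NI mh by blast
    qed
    then have "{m, h m} \<union> ((N m - N (h m)) \<union> (N (h m) - N m)) \<subseteq> ?P - W"
      using NP(1) mh mS by (auto simp: W_def)
    then have "card ({m, h m} \<union> ((N m - N (h m)) \<union> (N (h m) - N m))) \<le> card (?P - W)"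
      using finite_fv[OF f] by (intro card_mono) auto
    moreover have "4 \<le> card ({m, h m} \<union> ((N m - N (h m)) \<union> (N (h m) - N m)))"
      unfolding N_def using m(2) by (intro face_neighbourhoods_differ[OF f mh]) auto
    ultimately show ?thesis by linarith
  qed
  ultimately show False using few by linarith
qed

text \<open>
  The hypotheses say that \<open>A\<close> induces a tree. A tree with at most three vertices is a path with at most two edges,
  and any two edges at a vertex of a cubic map lie on a common face.
\<close>

lemma tiny_set_in_face:
  assumes A: "A \<subseteq> V" "A \<noteq> {}" and cut: "card A + 2 = card (crossing E A)" "card (crossing E A) \<le> 5"
  obtains f where "f \<in> Fc" "A \<subseteq> fv f"
proof -
  have finA: "finite A" using finite_sub A(1) .
  have c: "card (inner_edges A) + 1 = card A"
    using vertices_edges_cut[OF A(1)] cut(1) by linarith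
  have "card A \<le> 3" using cut by linarith
  moreover have "card A \<noteq> 0" using A(2) finA by simp
  ultimately consider "card A = 1" | "card A = 2" | "card A = 3" by linarith
  then show thesis
  proof cases
    case 1
    then obtain v where "A = {v}" by (auto simp: card_1_singleton_iff)
    then show ?thesis using face_at_vertex[of v] A(1) that by auto
  next
    case 2
    then have "card (inner_edges A) = 1" using c by simp
    then obtain e where "inner_edges A = {e}" by (auto simp: card_1_singleton_iff)
    then have e: "e \<in> E" "e \<subseteq> A" by blast+
    have "e = A" using card_subset_eq[OF finA e(2)] edge[OF e(1)] 2 by simp
    obtain v where "v \<in> e" using edge[OF e(1)] by fastforce
    obtain f where "f \<in> Fc" "e \<in> fe f" by (rule face_through_two_edges[OF e(1) e(1) \<open>v \<in> e\<close> \<open>v \<in> e\<close>])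
    then show ?thesis using that face_edge_verts \<open>e = A\<close> by blast
  next
    case 3
    then have "card (inner_edges A) = 2" using c by simp
    then obtain e e' where ee: "inner_edges A = {e, e'}" "e \<noteq> e'" by (auto simp: card_2_iff)
    then have e: "e \<in> E" "e \<subseteq> A" "e' \<in> E" "e' \<subseteq> A" by blast+
    have c2: "card e = 2" "card e' = 2" using edge e by blast+
    have "e \<inter> e' \<noteq> {}" using c2 3 by (intro subsets_meet[OF finA e(2,4)]) simp
    then obtain v where v: "v \<in> e" "v \<in> e'" by blast
    obtain f where f: "f \<in> Fc" "e \<in> fe f" "e' \<in> fe f"
      by (rule face_through_two_edges[OF e(1,3) v])
    have "e \<noteq> e \<union> e'"
    proof
      assume "e = e \<union> e'"
      then have "e' \<subseteq> e" by blast
      then have "e' = e" using card_subset_eq[of e e'] c2 finA e(2) by (simp add: finite_subset)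
      then show False using ee(2) by simp
    qed
    then have "e \<subset> e \<union> e'" by blast
    moreover have fin: "finite (e \<union> e')" using finA e by (auto intro: finite_subset)
    ultimately have "card e < card (e \<union> e')" by (intro psubset_card_mono)
    moreover have "card (e \<union> e') \<le> card A" using finA e by (intro card_mono) auto
    ultimately have "card (e \<union> e') = card A" using c2 3 by linarith
    then have "e \<union> e' = A" using card_subset_eq[OF finA, of "e \<union> e'"] e by blast
    then show ?thesis using that[OF f(1)] face_edge_verts[OF f(1)] f(2,3) by blast
  qed
qed

text \<open>
  The vertices outside \<open>C\<close> and \<open>R\<close> are distributed by majority. One that joins \<open>C\<close> has at most one edge
  that does not lead to \<open>C\<close>, and one that does not join has at most one edge to \<open>C\<close>. The set \<open>L x\<close> consists of
  the edges charged to \<open>x\<close>; an edge between two such vertices is charged to the one that joins.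
\<close>

theorem weakly_linked_part_in_face:
  assumes CR: "C \<subseteq> V" "R \<subseteq> V" "C \<inter> R = {}" "C \<noteq> {}" and R6: "6 \<le> card R"
    and link: "card {e \<in> E. \<exists>x\<in>C. \<exists>y\<in>R. e = {x, y}} + card (V - (C \<union> R)) \<le> 5"
  obtains f where "f \<in> Fc" "C \<subseteq> fv f"
proof -
  define X where "X = V - (C \<union> R)"
  define nC where "nC x = card {e \<in> E. x \<in> e \<and> e \<inter> C \<noteq> {}}" for x
  define A where "A = C \<union> {x \<in> X. 2 \<le> nC x}"
  let ?CR = "{e \<in> E. \<exists>x\<in>C. \<exists>y\<in>R. e = {x, y}}"
  define L where "L x = (if x \<in> A then {e \<in> E. x \<in> e \<and> e \<inter> C = {}} else {e \<in> E. x \<in> e \<and> e \<inter> C \<noteq> {}})"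
    for x
  have finX: "finite X" using finite_V by (simp add: X_def)
  have AV: "A \<subseteq> V" "A \<inter> R = {}" "C \<subseteq> A" "A \<noteq> {}" using CR by (auto simp: A_def X_def)
  have L1: "card (L x) \<le> 1" if x: "x \<in> X" for x
  proof (cases "x \<in> A")
    case True
    then have "2 \<le> nC x" using x by (auto simp: A_def X_def)
    moreover have "card {e \<in> E. x \<in> e} = nC x + card {e \<in> E. x \<in> e \<and> e \<inter> C = {}}"
    proof -
      have "{e \<in> E. x \<in> e} = {e \<in> E. x \<in> e \<and> e \<inter> C \<noteq> {}} \<union> {e \<in> E. x \<in> e \<and> e \<inter> C = {}}"
        by blast
      moreover have "card ({e \<in> E. x \<in> e \<and> e \<inter> C \<noteq> {}} \<union> {e \<in> E. x \<in> e \<and> e \<inter> C = {}}) =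
          nC x + card {e \<in> E. x \<in> e \<and> e \<inter> C = {}}"
        unfolding nC_def using finite_E by (intro card_Un_disjoint) auto
      ultimately show ?thesis by (simp only:)
    qed
    moreover have "card {e \<in> E. x \<in> e} = 3" using degree x by (simp add: X_def)
    ultimately have "card {e \<in> E. x \<in> e \<and> e \<inter> C = {}} \<le> 1" by linarith
    then show ?thesis using True by (simp only: L_def if_True)
  next
    case False
    then have "\<not> 2 \<le> nC x" using x by (auto simp: A_def)
    then have "nC x \<le> 1" by linarith
    then show ?thesis using False by (simp only: L_def if_False nC_def)
  qed
  have "crossing E A \<subseteq> ?CR \<union> (\<Union>x\<in>X. L x)"
  proof
    fix e assume e: "e \<in> crossing E A"
    then have eE: "e \<in> E" by (simp add: crossing_def)
    obtain a b where ab: "e = {a, b}" "a \<in> A" "b \<notin> A"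
    proof -
      obtain a b where "e = {a, b}" using edge[OF eE] by (auto simp: card_2_iff)
      then show thesis using that[of a b] that[of b a] e by (auto simp: crossing_def insert_commute)
    qed
    have b: "b \<in> V" "b \<notin> C" using edge[OF eE] ab AV by auto
    show "e \<in> ?CR \<union> (\<Union>x\<in>X. L x)"
    proof (cases "a \<in> C")
      case True
      show ?thesis
      proof (cases "b \<in> R")
        case True
        then show ?thesis using eE ab \<open>a \<in> C\<close> by blast
      next
        case False
        then have "b \<in> X" using b by (simp add: X_def)
        moreover have "e \<in> L b" using eE ab \<open>a \<in> C\<close> by (auto simp: L_def)
        ultimately show ?thesis by blast
      qed
    next
      case False
      then have "a \<in> X" using ab(2) by (auto simp: A_def)
      moreover have "e \<in> L a" using eE ab False b by (auto simp: L_def)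
      ultimately show ?thesis by blast
    qed
  qed
  then have "card (crossing E A) \<le> card (?CR \<union> (\<Union>x\<in>X. L x))"
    using finite_E finX by (intro card_mono) (auto simp: L_def)
  also have "\<dots> \<le> card ?CR + card (\<Union>x\<in>X. L x)" by (rule card_Un_le)
  also have "card (\<Union>x\<in>X. L x) \<le> (\<Sum>x\<in>X. card (L x))" by (rule card_UN_le[OF finX])
  also have "(\<Sum>x\<in>X. card (L x)) \<le> (\<Sum>x\<in>X. 1)" using L1 by (rule sum_mono)
  finally have cut: "card (crossing E A) \<le> 5" using link by (simp add: X_def)
  have "R \<noteq> {}" using R6 by auto
  then have "A \<noteq> V" using AV CR by blast
  have "card R \<le> card (V - A)" using AV CR finite_V by (intro card_mono) auto
  then have B6: "6 \<le> card (V - A)" using R6 by linarith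
  have "\<not> card (inner_pentagons (V - A)) \<le> 6"
  proof
    assume pB: "card (inner_pentagons (V - A)) \<le> 6"
    have "V - A \<noteq> V" using AV by blast
    moreover have "card (crossing E (V - A)) \<le> 5" using cut crossing_Compl[OF AV(1)] by simp
    ultimately have "V - A = {} \<or> card (V - A) + 2 = card (crossing E (V - A)) \<or>
      card (crossing E (V - A)) = 5 \<and> (\<exists>f\<in>Fc. card (fv f) = 5 \<and> fv f = V - A)"
      using pB by (intro small_cuts) auto
    moreover have "V - A \<noteq> {}" using B6 by (metis card.empty not_numeral_le_zero)
    ultimately show False
      using B6 \<open>card (crossing E (V - A)) \<le> 5\<close> by (auto simp del: Diff_eq_empty_iff)
  qed
  then have "card (inner_pentagons A) \<le> 6" using half_has_few_pentagons[OF AV(1)] by blast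
  from small_cuts[OF AV(1) \<open>A \<noteq> V\<close> cut this] AV(4)
  consider "card A + 2 = card (crossing E A)" | f where "f \<in> Fc" "fv f = A" by blast
  then show thesis
  proof cases
    case 1
    obtain f where "f \<in> Fc" "A \<subseteq> fv f" by (rule tiny_set_in_face[OF AV(1,4) 1 cut])
    then show ?thesis using that AV(3) by blast
  next
    case 2
    then show ?thesis using that AV(3) by blast
  qed
qed

end

section \<open>Faces of a plane drawing\<close>

locale plane_drawing =
  fixes F :: "'a drawn_graph"
  assumes plane: "plane_graph F"
begin

abbreviation "pos \<equiv> position F"
abbreviation "crv e \<equiv> path_image (curve F e)"

lemma finite_verts: "finite (verts F)"
  using plane by (simp add: plane_graph_def simple_graph_def)

lemma edge: "e \<in> edges F \<Longrightarrow> e \<subseteq> verts F \<and> card e = 2"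
  using plane by (simp add: plane_graph_def simple_graph_def)

lemma finite_edges: "finite (edges F)"
  using edge finite_verts by (intro finite_subset[of "edges F" "Pow (verts F)"]) auto

lemma inj_pos: "inj_on pos (verts F)"
  using plane by (simp add: plane_graph_def)

lemma arc_curve: "e \<in> edges F \<Longrightarrow> arc (curve F e)"
  using plane by (simp add: plane_graph_def)

lemma curve_ends:
  "e \<in> edges F \<Longrightarrow> {pathstart (curve F e), pathfinish (curve F e)} = pos ` e"
  using plane by (simp add: plane_graph_def)

lemma curve_Int_verts: "e \<in> edges F \<Longrightarrow> crv e \<inter> pos ` verts F = pos ` e"
  using plane by (simp add: plane_graph_def)

lemma curve_Int_curve:
  "e \<in> edges F \<Longrightarrow> e' \<in> edges F \<Longrightarrow> e \<noteq> e' \<Longrightarrow> crv e \<inter> crv e' = pos ` (e \<inter> e')"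
  using plane by (simp add: plane_graph_def)

lemma edge_arc:
  assumes "{u, v} \<in> edges F"
  obtains g where "arc g" "pathstart g = pos u" "pathfinish g = pos v" "path_image g = crv {u, v}"
proof -
  let ?c = "curve F {u, v}"
  have "{pathstart ?c, pathfinish ?c} = {pos u, pos v}" using curve_ends[OF assms] by simp
  then consider "pathstart ?c = pos u" "pathfinish ?c = pos v"
    | "pathstart ?c = pos v" "pathfinish ?c = pos u"
    by (auto simp: doubleton_eq_iff)
  then show thesis
  proof cases
    case 1
    then show ?thesis using that[of ?c] arc_curve[OF assms] by simp
  next
    case 2
    then show ?thesis using that[of "reversepath ?c"] arc_curve[OF assms]
      by (simp add: arc_reversepath)
  qed
qed

lemma path_arc:
  assumes "distinct p" "2 \<le> length p" "path_edges p \<subseteq> edges F"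
  shows "\<exists>g. arc g \<and> pathstart g = pos (hd p) \<and> pathfinish g = pos (last p) \<and>
    path_image g = \<Union>(crv ` path_edges p)"
  using assms
proof (induction p rule: path_edges.induct)
  case (1 x y p)
  have xy: "{x, y} \<in> edges F" using 1 by simp
  obtain h where h: "arc h" "pathstart h = pos x" "pathfinish h = pos y" "path_image h = crv {x, y}"
    by (rule edge_arc[OF xy])
  show ?case
  proof (cases "p = []")
    case True
    then show ?thesis using h by (intro exI[of _ h]) simp
  next
    case False
    then have "2 \<le> length (y # p)" by (cases p) auto
    then obtain g where g: "arc g" "pathstart g = pos y" "pathfinish g = pos (last p)"
      "path_image g = \<Union>(crv ` path_edges (y # p))"
      using 1 False by auto
    have "path_image h \<inter> path_image g \<subseteq> {pos y}"
    proof
      fix q assume q: "q \<in> path_image h \<inter> path_image g"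
      then obtain e where e: "e \<in> path_edges (y # p)" "q \<in> crv e" using g by auto
      have x: "x \<notin> e" using path_edges_subset[OF e(1)] 1 by auto
      have "e \<in> edges F" using e 1 by auto
      then have "crv {x, y} \<inter> crv e = pos ` ({x, y} \<inter> e)"
        using xy x by (intro curve_Int_curve) auto
      then show "q \<in> {pos y}" using q e h x by auto
    qed
    then have "arc (h +++ g)" using h g by (intro arc_join) auto
    moreover have "path_image (h +++ g) = \<Union>(crv ` path_edges (x # y # p))"
      using h g by (simp add: path_image_join)
    ultimately show ?thesis using h g False by (intro exI[of _ "h +++ g"]) simp
  qed
qed auto

lemma cycle_loop:
  assumes "is_cycle F c"
  obtains g where "simple_path g" "pathfinish g = pathstart g"
    "path_image g = \<Union>(crv ` cycle_edges c)"
proof -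
  have "3 \<le> length c" using assms by (simp add: is_cycle_def)
  then obtain x y z q where c_eq: "c = x # y # z # q"
    by (metis Suc_le_length_iff numeral_3_eq_3)
  define r where "r = z # q"
  have c: "c = x # y # r" "r \<noteq> []" by (simp_all add: c_eq r_def)
  have dist: "distinct (x # y # r)" using assms c(1) by (simp add: is_cycle_def)
  have ce: "cycle_edges c = insert {last r, x} (path_edges c)"
    unfolding c(1) by (rule cycle_edges_Cons_Cons[OF c(2)])
  have sub: "{last r, x} \<in> edges F" "path_edges c \<subseteq> edges F"
    using assms ce by (auto simp: is_cycle_def)
  obtain g where g: "arc g" "pathstart g = pos x" "pathfinish g = pos (last r)"
    "path_image g = \<Union>(crv ` path_edges c)"
    using path_arc[of c] dist sub c by auto
  obtain h where h: "arc h" "pathstart h = pos (last r)" "pathfinish h = pos x"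
    "path_image h = crv {last r, x}"
    by (rule edge_arc[OF sub(1)])
  have "path_image g \<inter> path_image h \<subseteq> {pathstart g, pathstart h}"
  proof
    fix q assume q: "q \<in> path_image g \<inter> path_image h"
    then obtain e where e: "e \<in> path_edges c" "q \<in> crv e" using g by auto
    have "e \<noteq> {last r, x}" using closing_edge_notin_path[OF dist c(2)] e c by auto
    then have "crv e \<inter> crv {last r, x} = pos ` (e \<inter> {last r, x})"
      using e sub by (intro curve_Int_curve) auto
    then show "q \<in> {pathstart g, pathstart h}" using q e g h by auto
  qed
  then have "simple_path (g +++ h)"
    using g h by (intro simple_path_join_loop) auto
  moreover have "path_image (g +++ h) = \<Union>(crv ` cycle_edges c)"
    using g h ce by (simp add: path_image_join Un_commute)
  ultimately show thesis using that[of "g +++ h"] g h by simp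
qed

text \<open>
  The midpoint of a curve stands for the whole edge: it lies on no other curve and on no vertex, so
  near it the drawing consists of that one edge.
\<close>

definition mid :: "'a set \<Rightarrow> complex" where
  "mid e = curve F e (1/2)"

lemma mid_in_curve: "mid e \<in> crv e"
  by (simp add: mid_def path_image_def)

lemma mid_notin_verts:
  assumes "e \<in> edges F"
  shows "mid e \<notin> pos ` e"
proof
  assume "mid e \<in> pos ` e"
  then have "curve F e (1/2) = curve F e 0 \<or> curve F e (1/2) = curve F e 1"
    using curve_ends[OF assms] by (auto simp: mid_def pathstart_def pathfinish_def)
  moreover have "inj_on (curve F e) {0..1}" using arc_curve[OF assms] by (simp add: arc_def)
  ultimately show False by (auto dest: inj_onD[where x = "1/2" and y = 0] inj_onD[where x = "1/2" and y = 1])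
qed

lemma mid_notin_curve:
  assumes "e \<in> edges F" "e' \<in> edges F" "mid e \<in> crv e'"
  shows "e = e'"
proof (rule ccontr)
  assume "e \<noteq> e'"
  then have "mid e \<in> pos ` (e \<inter> e')" using curve_Int_curve assms mid_in_curve by blast
  then show False using mid_notin_verts[OF assms(1)] by blast
qed

definition rest :: "'a set \<Rightarrow> complex set" where
  "rest e = pos ` verts F \<union> \<Union>(crv ` (edges F - {e}))"

lemma drawing_eq_rest: "e \<in> edges F \<Longrightarrow> drawing F = rest e \<union> crv e"
  by (auto simp: drawing_def rest_def)

lemma closed_rest: "closed (rest e)"
  unfolding rest_def using finite_verts finite_edges arc_curve
  by (intro closed_Un closed_UN) (auto intro!: finite_imp_closed closed_arc_image)

lemma closed_drawing: "closed (drawing F)"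
  unfolding drawing_def using finite_verts finite_edges arc_curve
  by (intro closed_Un closed_UN) (auto intro!: finite_imp_closed closed_arc_image)

lemma mid_notin_rest:
  assumes "e \<in> edges F"
  shows "mid e \<notin> rest e"
  using mid_notin_curve[OF assms] curve_Int_verts[OF assms] mid_notin_verts[OF assms]
    mid_in_curve[of e] by (auto simp: rest_def)

lemma curve_Int_rest:
  assumes "e \<in> edges F"
  shows "crv e \<inter> rest e \<subseteq> pos ` e"
proof
  fix q assume q: "q \<in> crv e \<inter> rest e"
  then consider "q \<in> pos ` verts F" | d where "d \<in> edges F" "d \<noteq> e" "q \<in> crv d"
    by (auto simp: rest_def)
  then show "q \<in> pos ` e"
  proof cases
    case 1
    then show ?thesis using curve_Int_verts[OF assms] q by blast
  next
    case 2
    then show ?thesis using curve_Int_curve[OF assms 2(1)] q by auto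
  qed
qed

lemma face_props:
  assumes "f \<in> faces F"
  shows "open f" "connected f" "f \<noteq> {}" "f \<inter> drawing F = {}"
  using assms closed_drawing unfolding faces_def
  by (auto intro: open_components in_components_connected dest: in_components_nonempty in_components_subset)

lemma faces_disjoint: "f \<in> faces F \<Longrightarrow> g \<in> faces F \<Longrightarrow> f \<noteq> g \<Longrightarrow> f \<inter> g = {}"
  unfolding faces_def using components_nonoverlap by blast

lemma point_in_face:
  assumes "q \<notin> drawing F"
  obtains f where "f \<in> faces F" "q \<in> f"
  using assms Union_components[of "- drawing F"] unfolding faces_def by blast

lemma cycle_sides:
  assumes "is_cycle F c"
  obtains I U where "open I" "open U" "connected I" "connected U" "I \<inter> U = {}"
    "I \<union> U = - \<Union>(crv ` cycle_edges c)" "frontier I = \<Union>(crv ` cycle_edges c)"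
    "frontier U = \<Union>(crv ` cycle_edges c)"
proof -
  obtain g where g: "simple_path g" "pathfinish g = pathstart g"
    "path_image g = \<Union>(crv ` cycle_edges c)"
    by (rule cycle_loop[OF assms])
  show thesis
  proof (rule Jordan_curve[OF g(1,2)])
    fix I U :: "complex set"
    assume "open I" "connected I" "open U" "connected U" "I \<inter> U = {}"
      "I \<union> U = - path_image g" "frontier I = path_image g" "frontier U = path_image g"
    then show thesis using that[of I U] g(3) by simp
  qed
qed

lemma cycle_subset_drawing: "is_cycle F c \<Longrightarrow> \<Union>(crv ` cycle_edges c) \<subseteq> drawing F"
  by (auto simp: is_cycle_def drawing_def)

text \<open>
  Faces are connected and avoid the drawing, so they do not cross a cycle.
\<close>

lemma face_on_side:
  assumes "is_cycle F c" "f \<in> faces F" "open I" "open U" "I \<inter> U = {}"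
    "I \<union> U = - \<Union>(crv ` cycle_edges c)" "f \<inter> I \<noteq> {}"
  shows "f \<subseteq> I"
proof (rule ccontr)
  assume "\<not> f \<subseteq> I"
  have "f \<subseteq> I \<union> U"
    using cycle_subset_drawing[OF assms(1)] face_props(4)[OF assms(2)] assms(6) by blast
  then have "f \<inter> U \<noteq> {}" using \<open>\<not> f \<subseteq> I\<close> by blast
  then show False
    using connectedD[OF face_props(2)[OF assms(2)] assms(3,4)] assms(5,7) \<open>f \<subseteq> I \<union> U\<close> by blast
qed

text \<open>
  A face whose frontier is the whole cycle fills one side of it, since inside that side there is no frontier
  point to stop at.
\<close>

lemma face_eq_side:
  assumes "frontier f = J" "connected I" "f \<subseteq> I" "f \<noteq> {}" "I \<inter> J = {}"
  shows "f = I"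
  using connected_Int_frontier[OF assms(2), of f] assms by blast

end

text \<open>
  The second assumption says that the graph has no bridge; a bridge would have the same face on both sides.
\<close>

locale cycle_faces = plane_drawing +
  assumes face_cycle: "f \<in> faces F \<Longrightarrow> \<exists>c. is_cycle F c \<and> frontier f = \<Union>(crv ` cycle_edges c)"
    and edge_on_cycle: "e \<in> edges F \<Longrightarrow> \<exists>c. is_cycle F c \<and> e \<in> cycle_edges c"
begin

lemma face_edges_eq:
  assumes "is_cycle F c" "frontier f = \<Union>(crv ` cycle_edges c)"
  shows "face_edges F f = cycle_edges c"
proof
  have c: "cycle_edges c \<subseteq> edges F" using assms(1) by (simp add: is_cycle_def)
  show "face_edges F f \<subseteq> cycle_edges c"
  proof
    fix e assume "e \<in> face_edges F f"
    then have e: "e \<in> edges F" "crv e \<subseteq> \<Union>(crv ` cycle_edges c)"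
      using assms(2) by (auto simp: face_edges_def)
    then obtain d where d: "d \<in> cycle_edges c" "mid e \<in> crv d" using mid_in_curve by blast
    then show "e \<in> cycle_edges c" using mid_notin_curve e c by blast
  qed
  show "cycle_edges c \<subseteq> face_edges F f" using assms(2) c by (auto simp: face_edges_def)
qed

lemma face_verts_eq:
  assumes "is_cycle F c" "frontier f = \<Union>(crv ` cycle_edges c)"
  shows "face_verts F f = set c"
proof
  have c: "cycle_edges c \<subseteq> edges F" using assms(1) by (simp add: is_cycle_def)
  show "face_verts F f \<subseteq> set c"
  proof
    fix v assume "v \<in> face_verts F f"
    then obtain e where e: "v \<in> verts F" "e \<in> cycle_edges c" "pos v \<in> crv e"
      using assms(2) by (auto simp: face_verts_def)
    have eF: "e \<in> edges F" using e c by blast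
    have "pos v \<in> pos ` e" using curve_Int_verts[OF eF] e by blast
    then have "v \<in> e"
      using inj_on_image_mem_iff[OF inj_pos e(1)] edge[OF eF] by blast
    then show "v \<in> set c" using Union_cycle_edges[OF assms(1)] e(2) by blast
  qed
  show "set c \<subseteq> face_verts F f"
  proof
    fix v assume "v \<in> set c"
    then obtain e where e: "e \<in> cycle_edges c" "v \<in> e"
      using Union_cycle_edges[OF assms(1)] by blast
    have eF: "e \<in> edges F" using e c by blast
    have "pos v \<in> crv e" using curve_Int_verts[OF eF] e(2) by blast
    then show "v \<in> face_verts F f"
      using assms(2) e edge[OF eF] by (auto simp: face_verts_def)
  qed
qed

lemma face_cycleE:
  assumes "f \<in> faces F"
  obtains c where "is_cycle F c" "frontier f = \<Union>(crv ` cycle_edges c)"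
    "face_edges F f = cycle_edges c" "face_verts F f = set c"
proof -
  obtain c where c: "is_cycle F c" "frontier f = \<Union>(crv ` cycle_edges c)"
    using face_cycle[OF assms] by blast
  show thesis by (rule that[OF c face_edges_eq[OF c] face_verts_eq[OF c]])
qed

lemma face_edge_closure:
  assumes "f \<in> faces F" "e \<in> edges F"
  shows "e \<in> face_edges F f \<longleftrightarrow> mid e \<in> closure f"
proof
  assume "e \<in> face_edges F f"
  then show "mid e \<in> closure f"
    using mid_in_curve[of e] by (auto simp: face_edges_def frontier_def)
next
  assume cl: "mid e \<in> closure f"
  obtain c where c: "is_cycle F c" "frontier f = \<Union>(crv ` cycle_edges c)"
    "face_edges F f = cycle_edges c" by (rule face_cycleE[OF assms(1)])
  have "mid e \<in> drawing F" using assms(2) mid_in_curve[of e] by (auto simp: drawing_def)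
  then have "mid e \<notin> f" using face_props(4)[OF assms(1)] by blast
  then have "mid e \<in> frontier f"
    using cl face_props(1)[OF assms(1)] by (simp add: frontier_def interior_open)
  then obtain d where "d \<in> cycle_edges c" "mid e \<in> crv d" using c by auto
  moreover have "cycle_edges c \<subseteq> edges F" using c by (simp add: is_cycle_def)
  ultimately show "e \<in> face_edges F f" using c(3) mid_notin_curve[OF assms(2)] by blast
qed

text \<open>
  A finite graph has finitely many cycles, and at most two faces have a given cycle as frontier: its two sides.
\<close>

lemma finite_faces: "finite (faces F)"
proof -
  define FC where "FC C = {f \<in> faces F. frontier f = \<Union>(crv ` C)}" for C
  have "finite (FC (cycle_edges c))" if c: "is_cycle F c" for c
  proof -
    obtain I U where IO: "open I" "open U" "connected I" "connected U" "I \<inter> U = {}"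
      "I \<union> U = - \<Union>(crv ` cycle_edges c)" "frontier I = \<Union>(crv ` cycle_edges c)"
      "frontier U = \<Union>(crv ` cycle_edges c)"
      by (rule cycle_sides[OF c])
    have "FC (cycle_edges c) \<subseteq> {I, U}"
    proof
      fix f assume "f \<in> FC (cycle_edges c)"
      then have f: "f \<in> faces F" "frontier f = \<Union>(crv ` cycle_edges c)" by (auto simp: FC_def)
      have "f \<subseteq> I \<union> U" "f \<noteq> {}"
        using cycle_subset_drawing[OF c] face_props[OF f(1)] IO(6) by blast+
      then consider "f \<inter> I \<noteq> {}" | "f \<inter> U \<noteq> {}" by blast
      then show "f \<in> {I, U}"
      proof cases
        case 1
        have "f \<subseteq> I" by (rule face_on_side[OF c f(1) IO(1,2,5,6) 1])
        then have "f = I" using IO(6) by (intro face_eq_side[OF f(2) IO(3) _ \<open>f \<noteq> {}\<close>]) auto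
        then show ?thesis by simp
      next
        case 2
        have "f \<subseteq> U"
          using face_on_side[OF c f(1) IO(2,1) _ _ 2] IO(5,6) by (simp add: Int_commute Un_commute)
        then have "f = U" using IO(6) by (intro face_eq_side[OF f(2) IO(4) _ \<open>f \<noteq> {}\<close>]) auto
        then show ?thesis by simp
      qed
    qed
    then show ?thesis by (rule finite_subset) simp
  qed
  then have "finite (\<Union>C\<in>{C \<in> Pow (edges F). \<exists>c. is_cycle F c \<and> C = cycle_edges c}. FC C)"
    using finite_edges by (intro finite_UN_I) auto
  moreover have "faces F \<subseteq> (\<Union>C\<in>{C \<in> Pow (edges F). \<exists>c. is_cycle F c \<and> C = cycle_edges c}. FC C)"
  proof
    fix f assume f: "f \<in> faces F"
    then obtain c where c: "is_cycle F c" "frontier f = \<Union>(crv ` cycle_edges c)"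
      using face_cycle by blast
    then have "f \<in> FC (cycle_edges c)" "cycle_edges c \<in> Pow (edges F)"
      using f by (auto simp: FC_def is_cycle_def)
    then show "f \<in> (\<Union>C\<in>{C \<in> Pow (edges F). \<exists>c. is_cycle F c \<and> C = cycle_edges c}. FC C)"
      using c(1) by blast
  qed
  ultimately show ?thesis by (rule rev_finite_subset)
qed

text \<open>
  Close to the midpoint of \<open>e\<close>, points on the given side of the cycle avoid the drawing and so belong to faces on
  that side. As there are only finitely many faces, one of them has the midpoint in its closure.
\<close>

lemma face_on_each_side:
  assumes c: "is_cycle F c" "e \<in> cycle_edges c"
    and IO: "open I" "open U" "I \<inter> U = {}"
      "I \<union> U = - \<Union>(crv ` cycle_edges c)" "frontier I = \<Union>(crv ` cycle_edges c)"
  obtains f where "f \<in> faces F" "f \<subseteq> I" "e \<in> face_edges F f"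
proof -
  have e: "e \<in> edges F" using c by (auto simp: is_cycle_def)
  have "\<exists>f\<in>faces F. f \<subseteq> I \<and> mid e \<in> closure f"
  proof (rule ccontr)
    assume no: "\<not> ?thesis"
    define W where "W = - rest e - (\<Union>f\<in>{f \<in> faces F. f \<subseteq> I}. closure f)"
    have "open W" unfolding W_def
      using finite_faces closed_rest by (intro open_Diff closed_UN) (auto simp: open_Compl)
    moreover have "mid e \<in> W" using no mid_notin_rest[OF e] by (auto simp: W_def)
    moreover have "mid e \<in> closure I"
      using IO(5) c(2) mid_in_curve[of e] by (auto simp: frontier_def)
    ultimately obtain q where q: "q \<in> W" "q \<in> I"
      by (metis IntE all_not_in_conv closure_iff_nhds_not_empty open_Int_closure_eq_empty disjoint_iff)
    have "q \<notin> crv e" using q(2) IO(4) c(2) by blast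
    then have "q \<notin> drawing F" using q(1) drawing_eq_rest[OF e] by (auto simp: W_def)
    then obtain f where f: "f \<in> faces F" "q \<in> f" by (rule point_in_face)
    then have "f \<subseteq> I" using q(2) by (intro face_on_side[OF c(1) f(1) IO(1-4)]) auto
    then have "q \<in> (\<Union>f\<in>{f \<in> faces F. f \<subseteq> I}. closure f)" using f closure_subset by blast
    then show False using q(1) by (simp add: W_def)
  qed
  then show thesis using that face_edge_closure e by blast
qed

lemma cycle_minus_edge_connected:
  assumes "is_cycle F c" "e \<in> cycle_edges c"
  shows "connected (\<Union>(crv ` (cycle_edges c - {e})))" "e \<subseteq> \<Union>(cycle_edges c - {e})"
proof -
  obtain x y r where c': "is_cycle F (x # y # r)" "r \<noteq> []" "cycle_edges (x # y # r) = cycle_edges c"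
    "e = {last r, x}"
    by (rule cycle_through_edge[OF assms])
  have dist: "distinct (x # y # r)" using c' by (simp add: is_cycle_def)
  have ce: "cycle_edges c = insert e (path_edges (x # y # r))"
    using cycle_edges_Cons_Cons[OF c'(2), of x y] by (simp only: c'(3,4))
  have "e \<notin> path_edges (x # y # r)"
    unfolding c'(4) by (rule closing_edge_notin_path[OF dist c'(2)])
  then have eq: "cycle_edges c - {e} = path_edges (x # y # r)"
    unfolding ce by (rule Diff_insert_absorb)
  have "cycle_edges c \<subseteq> edges F" using assms(1) by (simp add: is_cycle_def)
  then have "path_edges (x # y # r) \<subseteq> edges F" using eq by (metis Diff_subset order_trans)
  then obtain g where "arc g" "path_image g = \<Union>(crv ` path_edges (x # y # r))"
    using path_arc[OF dist] by auto
  then show "connected (\<Union>(crv ` (cycle_edges c - {e})))"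
    using eq by (metis connected_arc_image)
  have "\<Union>(path_edges (x # y # r)) = set (x # y # r)" by (rule Union_path_edges) simp
  then show "e \<subseteq> \<Union>(cycle_edges c - {e})" using c'(2,4) unfolding eq by auto
qed

text \<open>
  The face \<open>f\<close> is one side of its boundary cycle \<open>J\<close>, so \<open>g\<close> and \<open>h\<close> are both on the other side and \<open>J\<close> does not
  separate them. The drawing without \<open>e\<close> does not separate them either, since they touch at the midpoint of \<open>e\<close>.
  These two closed sets cover the drawing, and they intersect in the rest of the cycle, which is
  connected. By Janiszewski's theorem the drawing does not separate \<open>g\<close> from \<open>h\<close>.
\<close>

lemma at_most_two_faces_at_edge:
  assumes f: "f \<in> faces F" "e \<in> face_edges F f" and g: "g \<in> faces F" "e \<in> face_edges F g"
    and h: "h \<in> faces F" "e \<in> face_edges F h" and "f \<noteq> g" "f \<noteq> h"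
  shows "g = h"
proof -
  have e: "e \<in> edges F" using f by (simp add: face_edges_def)
  obtain c where c: "is_cycle F c" "frontier f = \<Union>(crv ` cycle_edges c)"
    "face_edges F f = cycle_edges c" by (rule face_cycleE[OF f(1)])
  let ?J = "\<Union>(crv ` cycle_edges c)"
  have ec: "e \<in> cycle_edges c" using f c by simp
  have cE: "cycle_edges c \<subseteq> edges F" using c by (simp add: is_cycle_def)
  obtain U where U: "connected U" "g \<subseteq> U" "h \<subseteq> U" "U \<subseteq> - ?J"
  proof -
    obtain I U where IO: "open I" "open U" "connected I" "connected U" "I \<inter> U = {}"
      "I \<union> U = - ?J" "frontier I = ?J" "frontier U = ?J"
      by (rule cycle_sides[OF c(1)])
    have side: "k \<subseteq> I \<or> k \<subseteq> U" if "k \<in> faces F" for k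
    proof -
      have "k \<subseteq> I \<union> U" "k \<noteq> {}"
        using cycle_subset_drawing[OF c(1)] face_props[OF that] IO(6) by blast+
      then show ?thesis
        using face_on_side[OF c(1) that IO(1,2,5,6)] by blast
    qed
    have dis: "g \<inter> f = {}" "h \<inter> f = {}" using assms faces_disjoint by blast+
    have ne: "g \<noteq> {}" "h \<noteq> {}" "f \<noteq> {}" using face_props(3) f g h by blast+
    show thesis
    proof (cases "f \<subseteq> I")
      case True
      then have "f = I" using IO(6) by (intro face_eq_side[OF c(2) IO(3) _ ne(3)]) auto
      then have "g \<subseteq> U" "h \<subseteq> U" using side[OF g(1)] side[OF h(1)] dis ne by blast+
      then show ?thesis using that[OF IO(4)] IO(6) by blast
    next
      case False
      then have "f \<subseteq> U" using side[OF f(1)] by blast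
      then have "f = U" using IO(6) by (intro face_eq_side[OF c(2) IO(4) _ ne(3)]) auto
      then have "g \<subseteq> I" "h \<subseteq> I" using side[OF g(1)] side[OF h(1)] dis ne by blast+
      then show ?thesis using that[OF IO(3)] IO(6) by blast
    qed
  qed
  obtain x y where x: "x \<in> g" and y: "y \<in> h" using face_props(3) g h by blast
  have ccJ: "connected_component (- ?J) x y"
    using U x y unfolding connected_component_def by blast
  have ccR: "connected_component (- rest e) x y"
  proof -
    have ins: "connected (insert (mid e) k)" "insert (mid e) k \<subseteq> - rest e"
      if k: "k \<in> faces F" "e \<in> face_edges F k" for k
    proof -
      have "mid e \<in> closure k" using face_edge_closure[OF k(1) e] k(2) by simp
      then show "connected (insert (mid e) k)"
        using closure_subset by (intro connected_intermediate_closure[OF face_props(2)[OF k(1)]]) auto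
      have "k \<inter> rest e = {}" using face_props(4)[OF k(1)] drawing_eq_rest[OF e] by blast
      then show "insert (mid e) k \<subseteq> - rest e" using mid_notin_rest[OF e] by blast
    qed
    have "connected (insert (mid e) g \<union> insert (mid e) h)"
      using ins(1)[OF g] ins(1)[OF h] by (intro connected_Un) auto
    moreover have "insert (mid e) g \<union> insert (mid e) h \<subseteq> - rest e"
      using ins(2)[OF g] ins(2)[OF h] by blast
    ultimately show ?thesis unfolding connected_component_def using x y by blast
  qed
  have "?J \<inter> rest e = \<Union>(crv ` (cycle_edges c - {e}))"
  proof
    show "\<Union>(crv ` (cycle_edges c - {e})) \<subseteq> ?J \<inter> rest e"
      using cE by (auto simp: rest_def)
    show "?J \<inter> rest e \<subseteq> \<Union>(crv ` (cycle_edges c - {e}))"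
    proof
      fix q assume q: "q \<in> ?J \<inter> rest e"
      then obtain d where d: "d \<in> cycle_edges c" "q \<in> crv d" by blast
      show "q \<in> \<Union>(crv ` (cycle_edges c - {e}))"
      proof (cases "d = e")
        case True
        then have "q \<in> pos ` e" using curve_Int_rest[OF e] d q by blast
        then obtain v where v: "v \<in> e" "q = pos v" by blast
        then obtain k where k: "k \<in> cycle_edges c - {e}" "v \<in> k"
          using cycle_minus_edge_connected(2)[OF c(1) ec] by blast
        have "k \<in> edges F" using k cE by blast
        then have "q \<in> crv k" using curve_Int_verts[of k] k v by blast
        then show ?thesis using k by blast
      qed (use d in blast)
    qed
  qed
  then have conn: "connected (?J \<inter> rest e)"
    using cycle_minus_edge_connected(1)[OF c(1) ec] by simp
  have "compact ?J"
  proof -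
    obtain g where "simple_path g" "path_image g = ?J" by (rule cycle_loop[OF c(1)])
    then show ?thesis by (metis compact_simple_path_image)
  qed
  from Janiszewski[OF this closed_rest conn ccJ ccR]
  have "connected_component (- (?J \<union> rest e)) x y" .
  moreover have "?J \<union> rest e = drawing F"
    using cycle_subset_drawing[OF c(1)] drawing_eq_rest[OF e] ec by blast
  ultimately have "connected_component (- drawing F) x y" by simp
  then obtain T where T: "connected T" "T \<subseteq> - drawing F" "x \<in> T" "y \<in> T"
    unfolding connected_component_def by blast
  have "T \<subseteq> g"
    using T x g(1) unfolding faces_def by (intro components_maximal[of g "- drawing F"]) auto
  then show ?thesis using faces_disjoint[OF g(1) h(1)] y T(4) by blast
qed

lemma faces_at_edge_sides:
  assumes c: "is_cycle F c" "e \<in> cycle_edges c"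
    and IO: "open I" "open U" "I \<inter> U = {}"
      "I \<union> U = - \<Union>(crv ` cycle_edges c)" "frontier I = \<Union>(crv ` cycle_edges c)"
      "frontier U = \<Union>(crv ` cycle_edges c)"
  obtains f g where "f \<subseteq> I" "g \<subseteq> U" "f \<noteq> g" "\<not> g \<subseteq> I"
    "{k \<in> faces F. e \<in> face_edges F k} = {f, g}"
proof -
  obtain f where f: "f \<in> faces F" "f \<subseteq> I" "e \<in> face_edges F f"
    by (rule face_on_each_side[OF c IO(1-5)])
  have IO': "U \<inter> I = {}" "U \<union> I = - \<Union>(crv ` cycle_edges c)" using IO by auto
  obtain g where g: "g \<in> faces F" "g \<subseteq> U" "e \<in> face_edges F g"
    by (rule face_on_each_side[OF c IO(2,1) IO' IO(6)])
  have "f \<noteq> {}" "g \<noteq> {}" using face_props(3) f g by blast+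
  then have "f \<noteq> g" "\<not> g \<subseteq> I" using f(2) g(2) IO(3) by blast+
  moreover have "k = f \<or> k = g" if "k \<in> faces F" "e \<in> face_edges F k" for k
    using at_most_two_faces_at_edge[OF f(1,3) g(1,3) that \<open>f \<noteq> g\<close>] by blast
  then have "{k \<in> faces F. e \<in> face_edges F k} = {f, g}" using f g by blast
  ultimately show thesis using that f(2) g(2) by blast
qed

lemma card_faces_at_edge:
  assumes "e \<in> edges F"
  shows "card {f \<in> faces F. e \<in> face_edges F f} = 2"
proof -
  obtain c where c: "is_cycle F c" "e \<in> cycle_edges c" using edge_on_cycle[OF assms] by blast
  obtain I U where IO: "open I" "open U" "connected I" "connected U" "I \<inter> U = {}"
    "I \<union> U = - \<Union>(crv ` cycle_edges c)" "frontier I = \<Union>(crv ` cycle_edges c)"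
    "frontier U = \<Union>(crv ` cycle_edges c)"
    by (rule cycle_sides[OF c(1)])
  obtain f g where "f \<noteq> g" "{k \<in> faces F. e \<in> face_edges F k} = {f, g}"
    by (rule faces_at_edge_sides[OF c IO(1,2,5-8)])
  then show ?thesis by simp
qed

text \<open>
  One colour class consists of the faces on one side of the cycle. An edge off the cycle has its midpoint
  strictly on one side, and so both of its faces.
\<close>

lemma jordan_colouring:
  assumes c: "is_cycle F c"
  shows "\<exists>Q\<subseteq>faces F. \<forall>e\<in>edges F.
    e \<in> cycle_edges c \<longleftrightarrow> card {f \<in> Q. e \<in> face_edges F f} = 1"
proof -
  obtain I U where IO: "open I" "open U" "connected I" "connected U" "I \<inter> U = {}"
    "I \<union> U = - \<Union>(crv ` cycle_edges c)" "frontier I = \<Union>(crv ` cycle_edges c)"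
    "frontier U = \<Union>(crv ` cycle_edges c)"
    by (rule cycle_sides[OF c])
  define Q where "Q = {f \<in> faces F. f \<subseteq> I}"
  have "e \<in> cycle_edges c \<longleftrightarrow> card {f \<in> Q. e \<in> face_edges F f} = 1" if e: "e \<in> edges F" for e
  proof (cases "e \<in> cycle_edges c")
    case True
    obtain f g where fg: "f \<subseteq> I" "\<not> g \<subseteq> I" "{k \<in> faces F. e \<in> face_edges F k} = {f, g}"
      by (rule faces_at_edge_sides[OF c True IO(1,2,5-8)])
    have "{k \<in> Q. e \<in> face_edges F k} = {k \<in> {k \<in> faces F. e \<in> face_edges F k}. k \<subseteq> I}"
      by (auto simp: Q_def)
    also have "\<dots> = {f}" unfolding fg(3) using fg(1,2) by blast
    finally show ?thesis using True by simp
  next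
    case False
    have "mid e \<notin> \<Union>(crv ` cycle_edges c)"
      using mid_notin_curve[OF e] False c by (auto simp: is_cycle_def)
    then consider "mid e \<in> I" | "mid e \<in> U" using IO(6) by blast
    then have "card {f \<in> Q. e \<in> face_edges F f} \<noteq> 1"
    proof cases
      case 1
      have "f \<subseteq> I" if f: "f \<in> faces F" "e \<in> face_edges F f" for f
      proof -
        have "mid e \<in> closure f" using face_edge_closure[OF f(1) e] f(2) by simp
        then have "f \<inter> I \<noteq> {}"
          using 1 open_Int_closure_eq_empty[OF IO(1), of f] by blast
        then show ?thesis by (rule face_on_side[OF c f(1) IO(1,2,5,6)])
      qed
      then have "{f \<in> Q. e \<in> face_edges F f} = {f \<in> faces F. e \<in> face_edges F f}"
        by (auto simp: Q_def)
      then show ?thesis using card_faces_at_edge[OF e] by simp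
    next
      case 2
      have "\<not> f \<subseteq> I" if f: "f \<in> faces F" "e \<in> face_edges F f" for f
      proof -
        have "mid e \<in> closure f" using face_edge_closure[OF f(1) e] f(2) by simp
        then have "f \<inter> U \<noteq> {}"
          using 2 open_Int_closure_eq_empty[OF IO(2), of f] by blast
        then show ?thesis using IO(5) by blast
      qed
      then have "{f \<in> Q. e \<in> face_edges F f} = {}" by (auto simp: Q_def)
      then show ?thesis by (simp only: card.empty)
    qed
    then show ?thesis using False by simp
  qed
  then show ?thesis unfolding Q_def by (intro exI[of _ "{f \<in> faces F. f \<subseteq> I}"]) auto
qed

end

section \<open>Partial automorphisms of fullerenes\<close>

text \<open>
  If at most two edges leave \<open>S\<close>, deleting their ends in \<open>S\<close> separates the rest of \<open>S\<close> from the outside.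
  There is no rest only if \<open>S\<close> has one or two vertices, but then at least three edges leave it.
\<close>

lemma cubic_3_connected_edge_connectivity:
  fixes G :: "('a, 'b) graph_scheme"
  assumes "simple_graph G" "cubic G" "k_connected 3 G"
    and S: "S \<subseteq> verts G" "S \<noteq> {}" "S \<noteq> verts G"
  shows "3 \<le> card (crossing (edges G) S)"
proof (rule ccontr)
  assume "\<not> ?thesis"
  then have less: "card (crossing (edges G) S) < 3" by simp
  have finV: "finite (verts G)" and edge: "\<And>e. e \<in> edges G \<Longrightarrow> e \<subseteq> verts G \<and> card e = 2"
    using assms(1) by (auto simp: simple_graph_def)
  have finE: "finite (edges G)"
    using edge finV by (intro finite_subset[of "edges G" "Pow (verts G)"]) auto
  have finS: "finite S" using S(1) finV by (rule finite_subset)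
  have "\<forall>e\<in>crossing (edges G) S. \<exists>x. x \<in> e \<and> x \<in> S" by (auto simp: crossing_def)
  then obtain r where r: "\<forall>e\<in>crossing (edges G) S. r e \<in> e \<and> r e \<in> S"
    by (rule bchoice[THEN exE])
  define X where "X = r ` crossing (edges G) S"
  have XS: "X \<subseteq> S" using r by (auto simp: X_def)
  have "card X < 3"
    using card_image_le[OF finite_crossing[OF finE], of r S] less by (simp add: X_def)
  moreover have "X \<subseteq> verts G" using XS S(1) by blast
  ultimately have conn: "connected_induced G (verts G - X)"
    using assms(3) unfolding k_connected_def by blast
  have "S \<subseteq> X"
  proof (rule ccontr)
    assume "\<not> S \<subseteq> X"
    then obtain u where u: "u \<in> S" "u \<notin> X" by blast
    obtain v where v: "v \<in> verts G" "v \<notin> S" using S by blast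
    have "(u, v) \<in> {(x, y). {x, y} \<in> induced_edges G (verts G - X)}\<^sup>*"
      using conn u v XS S(1) unfolding connected_induced_def by blast
    then have "v \<in> S"
    proof (induction rule: rtrancl_induct)
      case (step x y)
      then have xy: "{x, y} \<in> edges G" "{x, y} \<subseteq> verts G - X" "x \<in> S"
        by (auto simp: induced_edges_def)
      show ?case
      proof (rule ccontr)
        assume "y \<notin> S"
        then have cr: "{x, y} \<in> crossing (edges G) S" using xy by (auto simp: crossing_def)
        then have "r {x, y} \<in> {x, y}" using r by blast
        moreover have "r {x, y} \<in> X" using cr by (simp add: X_def)
        ultimately show False using xy(2) by blast
      qed
    qed (use u in blast)
    then show False using v by blast
  qed
  then have "card S < 3" using \<open>card X < 3\<close> XS by auto
  moreover have "card S \<noteq> 0" using S(2) finS by simp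
  moreover have sum: "3 * card S = 2 * card {e \<in> edges G. e \<subseteq> S} + card (crossing (edges G) S)"
  proof -
    have "(\<Sum>v\<in>S. card {e \<in> edges G. v \<in> e}) = (\<Sum>v\<in>S. 3)"
      using assms(2) S(1) by (intro sum.cong) (auto simp: cubic_def)
    moreover have "(\<Sum>v\<in>S. card {e \<in> edges G. v \<in> e}) =
        2 * card {e \<in> edges G. e \<subseteq> S} + card (crossing (edges G) S)"
      using edge by (intro degree_sum finE finS) blast
    ultimately show ?thesis by simp
  qed
  moreover have "card {e \<in> edges G. e \<subseteq> S} \<le> card S - 1"
  proof (cases "card S = 1")
    case True
    have "\<not> e \<subseteq> S" if "e \<in> edges G" for e
      using card_mono[OF finS, of e] edge[OF that] True by auto
    then have "{e \<in> edges G. e \<subseteq> S} = {}" by blast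
    then show ?thesis by (simp only: card.empty)
  next
    case False
    then have S2: "card S = 2" using calculation(1,2) by linarith
    have "{e \<in> edges G. e \<subseteq> S} \<subseteq> {S}"
    proof
      fix e assume "e \<in> {e \<in> edges G. e \<subseteq> S}"
      then show "e \<in> {S}" using card_subset_eq[OF finS, of e] edge S2 by auto
    qed
    then have "card {e \<in> edges G. e \<subseteq> S} \<le> card {S}" by (intro card_mono) auto
    then show ?thesis using S2 by simp
  qed
  ultimately show False using less by linarith
qed

lemma fullerene_map_of_fullerene:
  fixes F :: "'a drawn_graph"
  assumes "fullerene F" "IPR F"
  shows "fullerene_map (verts F) (edges F) (faces F) (face_verts F) (face_edges F)"
proof -
  have F: "plane_graph F" "cubic F" "k_connected 3 F"
    and bounded: "\<And>f. f \<in> faces F \<Longrightarrow> pentagonal F f \<or> hexagonal F f"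
    using assms(1) by (auto simp: fullerene_def)
  have sg: "simple_graph F" using F(1) by (simp add: plane_graph_def)
  interpret plane_drawing F by unfold_locales (rule F(1))
  have ec: "3 \<le> card (crossing (edges F) S)" if "S \<subseteq> verts F" "S \<noteq> {}" "S \<noteq> verts F" for S
    by (rule cubic_3_connected_edge_connectivity[OF sg F(2,3) that])
  interpret cycle_faces F
  proof
    fix f assume "f \<in> faces F"
    then show "\<exists>c. is_cycle F c \<and> frontier f = \<Union>(crv ` cycle_edges c)"
      using bounded unfolding bounded_by_cycle_def by blast
  next
    fix e assume e: "e \<in> edges F"
    then obtain u v where uv: "e = {v, u}" "u \<noteq> v" using edge by (metis card_2_iff)
    then have V: "u \<in> verts F" "v \<in> verts F" using edge[OF e] by auto
    obtain p where p: "p \<noteq> []" "distinct p" "hd p = u" "last p = v" "path_edges p \<subseteq> edges F - {e}"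
    proof (rule path_if_not_separated[OF V, of "edges F - {e}"])
      show "\<And>d. d \<in> edges F - {e} \<Longrightarrow> d \<subseteq> verts F \<and> card d = 2" using edge by blast
      fix S assume S: "S \<subseteq> verts F" "v \<in> S" "u \<notin> S"
      then have "3 \<le> card (crossing (edges F) S)" using V by (intro ec) auto
      then have "\<not> crossing (edges F) S \<subseteq> {e}"
        using card_mono[of "{e}" "crossing (edges F) S"] by auto
      then show "crossing (edges F - {e}) S \<noteq> {}" by (auto simp: crossing_def)
    qed
    have "is_cycle F p" "cycle_edges p = insert {last p, hd p} (path_edges p)"
      using path_closes_to_cycle[OF p(1,2,5), of F] p e uv by auto
    then show "\<exists>c. is_cycle F c \<and> e \<in> cycle_edges c" using p uv by blast
  qed
  have size: "card (face_verts F f) = n" if n: "bounded_by_cycle F f n" for f n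
  proof -
    obtain c where c: "is_cycle F c" "length c = n" "frontier f = \<Union>(crv ` cycle_edges c)"
      using n by (auto simp: bounded_by_cycle_def)
    then show ?thesis
      using face_verts_eq[OF c(1,3)] distinct_card[of c] by (simp add: is_cycle_def)
  qed
  have pent: "pentagonal F f" if "f \<in> faces F" "card (face_verts F f) = 5" for f
    using bounded[OF that(1)] size[of f 6] that(2) by auto
  show ?thesis
  proof
    show "finite (verts F)" by (rule finite_verts)
    have "3 < card (verts F)" using F(3) by (simp add: k_connected_def)
    then show "verts F \<noteq> {}" by auto
    show "card {e \<in> edges F. v \<in> e} = 3" if "v \<in> verts F" for v
      using F(2) that by (simp add: cubic_def)
    show "finite (faces F)" by (rule finite_faces)
    fix f assume f: "f \<in> faces F"
    obtain c where c: "is_cycle F c" "face_edges F f = cycle_edges c" "face_verts F f = set c"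
      by (rule face_cycleE[OF f])
    show "face_verts F f \<subseteq> verts F" by (auto simp: face_verts_def)
    show "face_edges F f \<subseteq> edges F" by (auto simp: face_edges_def)
    show "card (face_verts F f) = 5 \<or> card (face_verts F f) = 6"
      using bounded[OF f] size by blast
    show "card {e \<in> face_edges F f. v \<in> e} = 2" if "v \<in> face_verts F f" for v
      using card_cycle_edges_at_vertex[OF c(1)] that c by simp
    show "e \<subseteq> face_verts F f" if "e \<in> face_edges F f" for e
      using Union_cycle_edges[OF c(1)] that c by blast
    have "c \<noteq> []" using c(1) by (auto simp: is_cycle_def)
    then show "connects (face_edges F f) (face_verts F f)"
      using connects_cycle_edges c by simp
    show "face_edges F f \<inter> face_edges F g = {}"
      if "g \<in> faces F" "f \<noteq> g" "card (face_verts F f) = 5" "card (face_verts F g) = 5" for g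
      using assms(2) pent f that unfolding IPR_def by blast
  next
    fix c assume "is_cycle \<lparr>verts = verts F, edges = edges F\<rparr> c"
    then have "is_cycle F c" by (simp add: is_cycle_def)
    then show "\<exists>Q\<subseteq>faces F. \<forall>e\<in>edges F.
        e \<in> cycle_edges c \<longleftrightarrow> card {f \<in> Q. e \<in> face_edges F f} = 1"
      by (rule jordan_colouring)
  qed (use edge ec card_faces_at_edge in auto)
qed

theorem theorem5:
  fixes F :: "'a drawn_graph" and \<phi> :: "'a \<rightharpoonup> 'a" and k :: nat
  assumes "fullerene F" and "IPR F"
    and "partial_automorphism F \<phi>" and "nontrivial \<phi>"
    and "k = deficiency F \<phi>" and "k \<in> {1, 2, 3}"
  shows "(\<forall>f\<in>faces F. \<not> supp \<phi> \<subseteq> face_verts F f) \<and>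
         \<not> (\<exists>C R. C \<union> R = dom \<phi> \<and> C \<inter> R = {} \<and> supp \<phi> \<subseteq> C \<and>
                  (\<forall>v\<in>R. \<phi> v = Some v) \<and> card R \<ge> 6 \<and>
                  card (edges_between F C R) \<le> 5 - k)"
proof -
  interpret fullerene_map "verts F" "edges F" "faces F" "face_verts F" "face_edges F"
    by (rule fullerene_map_of_fullerene[OF assms(1,2)])
  let ?D = "dom \<phi>" and ?h = "the \<circ> \<phi>"
  have D: "?D \<subseteq> verts F" and bij: "bij_betw ?h ?D (ran \<phi>)"
    and iso: "\<forall>x\<in>?D. \<forall>y\<in>?D. {x, y} \<in> induced_edges F ?D \<longleftrightarrow>
      {?h x, ?h y} \<in> induced_edges F (ran \<phi>)"
    using assms(3) by (auto simp: partial_automorphism_def graph_isomorphism_def)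
  have inj: "inj_on ?h ?D" using bij by (rule bij_betw_imp_inj_on)
  have hran: "?h x \<in> ran \<phi>" if "x \<in> ?D" for x using bij that by (rule bij_betwE[rule_format])
  have adj: "{x, y} \<in> edges F \<longleftrightarrow> {?h x, ?h y} \<in> edges F" if "x \<in> ?D" "y \<in> ?D" for x y
    using iso hran that by (simp add: induced_edges_def)
  have "finite ?D" using D finite_V by (rule finite_subset)
  then have "card (verts F - ?D) = k"
    using D assms(5) by (simp add: deficiency_def pa_rank_def card_Diff_subset)
  then have k: "card (verts F - ?D) = k" "k \<le> 3" using assms(6) by auto
  obtain m where m: "m \<in> ?D" "?h m \<noteq> m" using assms(4) by (auto simp: nontrivial_def)
  have supp: "x \<in> supp \<phi>" "?h x \<in> supp \<phi>" if x: "x \<in> ?D" "?h x \<noteq> x" for x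
  proof -
    show "x \<in> supp \<phi>" using x by (simp add: supp_def)
    have "the_inv_into ?D ?h (?h x) = x" by (rule the_inv_into_f_f[OF inj x(1)])
    then have "the_inv_into ?D ?h (?h x) \<noteq> ?h x" using x(2) by simp
    then show "?h x \<in> supp \<phi>" using hran[OF x(1)] unfolding supp_def by blast
  qed
  have part1: "\<not> supp \<phi> \<subseteq> face_verts F f" if f: "f \<in> faces F" for f
  proof
    assume sub: "supp \<phi> \<subseteq> face_verts F f"
    show False
    proof (rule not_face_localised[OF D inj adj _ f _ m])
      show "card (verts F - ?D) \<le> 3" using k by simp
      show "x \<in> face_verts F f \<and> ?h x \<in> face_verts F f" if "x \<in> ?D" "?h x \<noteq> x" for x
        using supp[OF that] sub by blast
    qed
  qed
  moreover have False
    if CR: "C \<union> R = ?D" "C \<inter> R = {}" "supp \<phi> \<subseteq> C" "card R \<ge> 6"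
      "card (edges_between F C R) \<le> 5 - k" for C R
  proof -
    have "m \<in> C" using supp(1)[OF m] CR(3) by blast
    then have "C \<noteq> {}" by blast
    have "card {e \<in> edges F. \<exists>x\<in>C. \<exists>y\<in>R. e = {x, y}} + card (verts F - (C \<union> R)) \<le> 5"
      using CR(1,5) k by (simp add: edges_between_def)
    then obtain f where "f \<in> faces F" "C \<subseteq> face_verts F f"
      using weakly_linked_part_in_face[of C R] CR(1,2,4) D \<open>C \<noteq> {}\<close> by blast
    then show False using part1 CR(3) by blast
  qed
  ultimately show ?thesis by blast
qed

end
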